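(* There exists an absolute constant $C>0$ such that the following holds. Let $k\geq 3$ be an integer, let $A$ be an abelian group, and let $\{H_i x_i : i\in[k]\}$ be an irredundant cover of $A$ by cosets (i.e. $H_1,\dots,H_k$ are subgroups of $A$, $x_1,\dots,x_k\in A$, $\bigcup_{i\in[k]}H_ix_i=A$, and no proper subcollection covers $A$). Then $$\Big|A:\bigcap_{i\in[k]}H_i\Big|\leq e^{Ck\log\log k}.$$
   Context: The paper states the conclusion as $|A:\bigcap_{i\in[k]}H_i|=e^{O(k\log\log k)}$; the claim above is the explicit form of this asymptotic statement. *)

theory Defs
  imports Complex_Main "HOL-Algebra.Algebra"
begin

(* Irredundancy is stated for the indexed family: no proper subset of the indices suffices.
   In particular the cosets are pairwise distinct, so there are exactly k of them. *)
definition irredundant_coset_cover ::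
    "('a, 'b) monoid_scheme \<Rightarrow> nat \<Rightarrow> (nat \<Rightarrow> 'a set) \<Rightarrow> (nat \<Rightarrow> 'a) \<Rightarrow> bool" where
  "irredundant_coset_cover A k H x \<longleftrightarrow>
     (\<forall>i\<in>{1..k}. subgroup (H i) A \<and> x i \<in> carrier A) \<and>
     (\<Union>i\<in>{1..k}. H i #>\<^bsub>A\<^esub> x i) = carrier A \<and>
     (\<forall>J. J \<subset> {1..k} \<longrightarrow> (\<Union>i\<in>J. H i #>\<^bsub>A\<^esub> x i) \<noteq> carrier A)"

(* |A : H| \<le> b.  Finiteness is required explicitly because card is 0 on infinite sets. *)
definition index_le :: "('a, 'b) monoid_scheme \<Rightarrow> 'a set \<Rightarrow> real \<Rightarrow> bool" where
  "index_le A H b \<longleftrightarrow> finite (rcosets\<^bsub>A\<^esub> H) \<and> real (card (rcosets\<^bsub>A\<^esub> H)) \<le> b"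

(* HOL cannot quantify over types inside a formula, so an existential quantifier over C placed in a
   statement that is polymorphic in the element type would only give a C for each type. To have one
   constant for all abelian groups, C is a closed term of type real: some positive constant that
   works for the groups carried by sets of natural numbers. Nothing is assumed about it; that it is
   positive and works for groups over every type has to be proved. *)
definition coset_cover_const :: real where
  "coset_cover_const = (SOME C. 0 < C \<and>
     (\<forall>(k::nat) (A :: nat monoid) H x.
        3 \<le> k \<longrightarrow> comm_group A \<longrightarrow> irredundant_coset_cover A k H x \<longrightarrow>
        index_le A (\<Inter>i\<in>{1..k}. H i) (exp (C * real k * ln (ln (real k))))))"

end

theory Submission
  imports Defs "HOL-Number_Theory.Residues" "HOL-Algebra.Weak_Morphisms"
begin

text \<open>Fix \<open>h\<close> with \<open>2 ^ h > k\<^sup>2\<close> and let \<open>g = h + 1\<close>. Give a prime \<open>p\<close> the weight \<open>t\<close>, where \<open>t\<close> is least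
  with \<open>p \<le> g ^ t\<close>, and extend additively; then \<open>n \<le> g ^ weight n\<close>, so it is enough that the index of
  the intersection has weight at most \<open>k\<close>. Otherwise choose a set \<open>I\<close> of indices that maximizes
  \<open>card I\<close> minus the weight of the index of \<open>D = (\<Inter>i\<in>I. H i)\<close>. It is proper, so some coset of \<open>D\<close> misses all
  the cosets with index in \<open>I\<close> and is covered by the others, whereas by the choice of \<open>I\<close> every set \<open>S\<close>
  of other indices cuts out of \<open>D\<close> a subgroup whose index has weight at least \<open>card S\<close>. The heart of
  the proof is that such families of cosets never cover.

  One first reduces to subgroups of one prime index \<open>p\<close>, that is, to linear forms over the field with
  \<open>p\<close> elements such that every \<open>S\<close> has rank at least \<open>card S / t\<close>. By matroid partition they split into \<open>t\<close>
  independent families. (If there are fewer than \<open>p\<close> forms, a greedy choice suffices.) A point where no form takes its forbidden value exists as soon as some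
  product of \<open>n (p - 1)\<close> linear forms in \<open>n\<close> variables that contains all the given forms has a nonzero sum
  over \<open>{0..<p} ^ n\<close>, since lower-degree terms have sum zero. The product of the \<open>(p - 1)\<close>-st powers of the
  coordinates has a nonzero sum. One inserts the families one after the other, with multiplicities
  \<open>g ^ (t - 1), \<dots>, g, 1\<close>, in exchange for factors already present. In each round of the exchange no factor
  loses more than one copy, and \<open>m\<close> rounds halve what is still missing of a family that is to be inserted with
  multiplicity \<open>m\<close>; hence \<open>m h\<close> rounds suffice, and every earlier form keeps at least one copy.\<close>

section \<open>Products of linear forms on a cube\<close>

text \<open>The functions given by an integer polynomial of degree at most \<open>d\<close> in the
  coordinates from \<open>N\<close>. Degree bounds on functions replace formal polynomials; sums
  over the cube are later evaluated along this induction.\<close>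

inductive poly_deg :: "'n set \<Rightarrow> nat \<Rightarrow> (('n \<Rightarrow> int) \<Rightarrow> int) \<Rightarrow> bool" for N where
  const: "poly_deg N d (\<lambda>x. c)"
| add: "poly_deg N d f \<Longrightarrow> poly_deg N d g \<Longrightarrow> poly_deg N d (\<lambda>x. f x + g x)"
| coord: "i \<in> N \<Longrightarrow> poly_deg N d f \<Longrightarrow> poly_deg N (Suc d) (\<lambda>x. x i * f x)"

lemma poly_deg_mono: "poly_deg N d f \<Longrightarrow> d \<le> e \<Longrightarrow> poly_deg N e f"
proof (induction arbitrary: e rule: poly_deg.induct)
  case (coord i d f)
  then obtain e' where "e = Suc e'" "d \<le> e'" by (cases e) auto
  then show ?case using coord by (auto intro: poly_deg.coord)
qed (auto intro: poly_deg.intros)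

lemma poly_deg_cmult: "poly_deg N d f \<Longrightarrow> poly_deg N d (\<lambda>x. c * f x)"
proof (induction rule: poly_deg.induct)
  case (coord i d f)
  have "poly_deg N (Suc d) (\<lambda>x. x i * (c * f x))" by (rule poly_deg.coord) (use coord in auto)
  then show ?case by (simp add: mult.left_commute)
qed (auto intro: poly_deg.intros simp: distrib_left)

lemma poly_deg_sum: "(\<And>i. i \<in> A \<Longrightarrow> poly_deg N d (f i)) \<Longrightarrow> poly_deg N d (\<lambda>x. \<Sum>i\<in>A. f i x)"
proof (induction A rule: infinite_finite_induct)
  case (insert a A)
  have "poly_deg N d (\<lambda>x. f a x + (\<Sum>i\<in>A. f i x))"
    by (intro poly_deg.add insert) (auto intro: insert)
  then show ?case using insert by simp
qed (auto intro: poly_deg.const)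

definition lin :: "'n set \<Rightarrow> ('n \<Rightarrow> int) \<Rightarrow> ('n \<Rightarrow> int) \<Rightarrow> int" where
  "lin N c x = (\<Sum>i\<in>N. c i * x i)"

lemma lin_add: "lin N c (\<lambda>i. x i + v i) = lin N c x + lin N c v"
  by (simp add: lin_def distrib_left sum.distrib)

lemma lin_diff: "lin N c (\<lambda>i. x i - v i) = lin N c x - lin N c v"
  by (simp add: lin_def right_diff_distrib sum_subtractf)

lemma lin_cong: "(\<And>i. i \<in> N \<Longrightarrow> [x i = y i] (mod m)) \<Longrightarrow> [lin N c x = lin N c y] (mod m)"
  unfolding lin_def by (intro cong_sum cong_mult) auto

lemma poly_deg_lin_mult:
  assumes "poly_deg N d f"
  shows "poly_deg N (Suc d) (\<lambda>x. lin N c x * f x)"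
proof -
  have "poly_deg N (Suc d) (\<lambda>x. \<Sum>i\<in>N. c i * (x i * f x))"
    by (intro poly_deg_sum poly_deg_cmult poly_deg.coord assms)
  then show ?thesis by (simp add: lin_def sum_distrib_right mult.assoc)
qed

lemma poly_deg_prod_lin:
  "poly_deg N (size Q) (\<lambda>x. \<Prod>l\<in>#Q. lin N (\<phi> l) x)"
proof (induction Q)
  case (add l Q)
  then show ?case using poly_deg_lin_mult[OF add, of "\<phi> l"] by simp
qed (auto intro: poly_deg.const)

text \<open>Constants subtracted from the factors do not affect the leading part. With one more
  affine factor, the new difference is the form times the old difference, minus \<open>a l\<close>
  times the old affine product.\<close>

lemma poly_deg_prod_affine:
  "size Q \<le> Suc d \<Longrightarrow>
   poly_deg N d (\<lambda>x. (\<Prod>l\<in>#Q. lin N (\<phi> l) x - a l) - (\<Prod>l\<in>#Q. lin N (\<phi> l) x))"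
proof (induction Q arbitrary: d)
  case (add l Q)
  let ?P = "\<lambda>x. \<Prod>l\<in>#Q. lin N (\<phi> l) x" and ?A = "\<lambda>x. \<Prod>l\<in>#Q. lin N (\<phi> l) x - a l"
  show ?case
  proof (cases "size Q = 0")
    case True
    then show ?thesis by (auto intro: poly_deg.const)
  next
    case False
    then obtain d' where d': "d = Suc d'" "size Q \<le> Suc d'" using add.prems by (cases d) auto
    have 1: "poly_deg N d (\<lambda>x. lin N (\<phi> l) x * (?A x - ?P x))"
      unfolding d' by (rule poly_deg_lin_mult) (rule add.IH[OF d'(2)])
    have 2: "poly_deg N d (\<lambda>x. (- a l) * ((?A x - ?P x) + ?P x))"
      by (intro poly_deg_cmult poly_deg.add)
        (use d' in \<open>auto intro: add.IH poly_deg_mono[OF poly_deg_prod_lin]\<close>)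
    show ?thesis using poly_deg.add[OF 1 2] by (simp add: algebra_simps)
  qed
qed (auto intro: poly_deg.const)

text \<open>First-order Taylor expansion: the remainder collects the products in which at least two
  factors are evaluated at \<open>v\<close>, so two degrees are lost. The derivative is a sum over
  the multiset, so a repeated factor contributes once per copy.\<close>

lemma poly_deg_prod_shift:
  "size Q \<le> d + 2 \<Longrightarrow> poly_deg N d
    (\<lambda>x. (\<Prod>l\<in>#Q. lin N (\<phi> l) x + lin N (\<phi> l) v) - (\<Prod>l\<in>#Q. lin N (\<phi> l) x)
       - (\<Sum>l\<in>#Q. lin N (\<phi> l) v * (\<Prod>k\<in>#Q - {#l#}. lin N (\<phi> k) x)))"
proof (induction Q arbitrary: d)
  case (add l Q)
  let ?P = "\<lambda>x. \<Prod>l\<in>#Q. lin N (\<phi> l) x"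
    and ?S = "\<lambda>x. \<Prod>l\<in>#Q. lin N (\<phi> l) x + lin N (\<phi> l) v"
    and ?D = "\<lambda>x. \<Sum>l\<in>#Q. lin N (\<phi> l) v * (\<Prod>k\<in>#Q - {#l#}. lin N (\<phi> k) x)"
  have D: "(\<Sum>k\<in>#Q. lin N (\<phi> k) v * (\<Prod>j\<in>#add_mset l Q - {#k#}. lin N (\<phi> j) x))
      = lin N (\<phi> l) x * ?D x" for x
  proof -
    have "(\<Sum>k\<in>#Q. lin N (\<phi> k) v * (\<Prod>j\<in>#add_mset l Q - {#k#}. lin N (\<phi> j) x))
      = (\<Sum>k\<in>#Q. lin N (\<phi> l) x * (lin N (\<phi> k) v * (\<Prod>j\<in>#Q - {#k#}. lin N (\<phi> j) x)))"
      by (intro arg_cong[of _ _ sum_mset] image_mset_cong) (auto simp: add_mset_remove_trivial_If)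
    also have "\<dots> = lin N (\<phi> l) x * ?D x" by (simp add: sum_mset_distrib_left)
    finally show ?thesis .
  qed
  show ?case
  proof (cases "size Q = 0")
    case True
    then show ?thesis by (auto intro: poly_deg.const)
  next
    case False
    have c2: "poly_deg N d (\<lambda>x. lin N (\<phi> l) v * (?S x - ?P x))"
    proof -
      have "poly_deg N d (\<lambda>x. (\<Prod>l\<in>#Q. lin N (\<phi> l) x - (- lin N (\<phi> l) v)) - ?P x)"
        by (rule poly_deg_prod_affine) (use add.prems in auto)
      then show ?thesis by (intro poly_deg_cmult) simp
    qed
    show ?thesis
    proof (cases d)
      \<comment> \<open>For \<open>d = 0\<close> the induction hypothesis has no smaller degree to
        offer; but then \<open>Q\<close> is a single form and the remainder is constant.\<close>
      case 0
      with add.prems False have "size Q = 1" by (auto simp: le_Suc_eq)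
      then obtain q where "Q = {#q#}" using size_1_singleton_mset by (metis One_nat_def)
      then show ?thesis using 0 by (simp add: algebra_simps poly_deg.const)
    next
      case (Suc d')
      have 1: "poly_deg N d (\<lambda>x. lin N (\<phi> l) x * (?S x - ?P x - ?D x))"
        unfolding Suc by (rule poly_deg_lin_mult) (rule add.IH, use Suc add.prems in auto)
      show ?thesis using poly_deg.add[OF 1 c2] D by (simp add: algebra_simps)
    qed
  qed
qed (auto intro: poly_deg.const)

text \<open>Telescoping \<open>(a + 1) ^ Suc e - a ^ Suc e\<close> over the residues writes
  \<open>p ^ Suc e\<close> as a combination of the power sums with exponents up to \<open>e\<close>.
  The last of them has coefficient \<open>e + 1 < p\<close>, which is invertible modulo
  \<open>p\<close>.\<close>

lemma power_sum_dvd: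
  assumes "Factorial_Ring.prime p" "e < p - 1"
  shows "int p dvd (\<Sum>a\<in>{0..<int p}. a ^ e)"
  using assms(2)
proof (induction e rule: less_induct)
  case (less e)
  have "(\<Sum>a\<in>{0..<int p}. a ^ e) = (\<Sum>a<p. int a ^ e)" for e
    by (rule sum.reindex_bij_witness[of _ int nat]) auto
  note eq = this
  have "(\<Sum>a<p. (int (Suc a)) ^ Suc e - int a ^ Suc e) = int p ^ Suc e"
    by (subst sum_lessThan_telescope) simp
  moreover have "(int (Suc a)) ^ Suc e - int a ^ Suc e = (\<Sum>i<Suc e. of_nat (Suc e choose i) * int a ^ i)" for a
  proof -
    have "(int a + 1) ^ Suc e = (\<Sum>i\<le>Suc e. of_nat (Suc e choose i) * int a ^ i)"
      by (subst binomial_ring) simp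
    also have "\<dots> = (\<Sum>i<Suc e. of_nat (Suc e choose i) * int a ^ i) + int a ^ Suc e"
      by (simp add: lessThan_Suc_atMost[symmetric])
    finally show ?thesis by (simp add: add.commute)
  qed
  ultimately have "int p ^ Suc e = (\<Sum>i<Suc e. of_nat (Suc e choose i) * (\<Sum>a<p. int a ^ i))"
    by (simp only: sum_distrib_left) (subst sum.swap, simp)
  also have "\<dots> = (\<Sum>i<e. of_nat (Suc e choose i) * (\<Sum>a<p. int a ^ i)) + (int e + 1) * (\<Sum>a<p. int a ^ e)"
    by (simp add: add.commute)
  finally have "(int e + 1) * (\<Sum>a<p. int a ^ e) = int p ^ Suc e - (\<Sum>i<e. of_nat (Suc e choose i) * (\<Sum>a<p. int a ^ i))"
    by simp
  moreover have "int p dvd (\<Sum>i<e. of_nat (Suc e choose i) * (\<Sum>a<p. int a ^ i))"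
    by (rule dvd_sum, rule dvd_mult) (use less in \<open>auto simp: eq\<close>)
  ultimately have "int p dvd (int e + 1) * (\<Sum>a<p. int a ^ e)" by (simp add: dvd_diff)
  moreover have "\<not> int p dvd int e + 1"
    using less.prems zdvd_imp_le[of "int p" "int e + 1"] by auto
  ultimately show ?case unfolding eq using assms(1) by (auto simp: prime_dvd_mult_iff)
qed

section \<open>Sums of low-degree polynomials over the cube, modulo a prime\<close>

abbreviation cube :: "nat \<Rightarrow> 'n set \<Rightarrow> ('n \<Rightarrow> int) set" where
  "cube p N \<equiv> PiE N (\<lambda>_. {0..<int p})"

text \<open>The principle behind Chevalley's theorem: a monomial of such small degree has an
  exponent below \<open>p - 1\<close>, and the sum over that coordinate alone vanishes modulo
  \<open>p\<close>.\<close>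

lemma poly_deg_sum_cube:
  assumes p: "Factorial_Ring.prime p" and N: "finite N" and f: "poly_deg N d f" and d: "d < card N * (p - 1)"
  shows "int p dvd (\<Sum>x\<in>cube p N. f x)"
proof -
  \<comment> \<open>Generalized by a monomial with exponents \<open>e\<close>, into which the rule
    \<open>coord\<close> moves one variable at a time until only a constant is left in front of
    it.\<close>
  have "poly_deg N d f \<Longrightarrow> d + (\<Sum>i\<in>N. e i) < card N * (p - 1) \<Longrightarrow>
     int p dvd (\<Sum>x\<in>cube p N. f x * (\<Prod>i\<in>N. x i ^ e i))" for e :: "'a \<Rightarrow> nat"
  proof (induction arbitrary: e rule: poly_deg.induct)
    case (const d c)
    have "\<exists>i\<in>N. e i < p - 1"
    proof (rule ccontr)
      assume "\<not> ?thesis"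
      then have "(\<Sum>i\<in>N. p - 1) \<le> (\<Sum>i\<in>N. e i)" by (intro sum_mono) auto
      then show False using const by simp
    qed
    then obtain i where i: "i \<in> N" "e i < p - 1" by blast
    have "(\<Sum>x\<in>cube p N. (\<Prod>i\<in>N. x i ^ e i)) = (\<Prod>i\<in>N. \<Sum>a\<in>{0..<int p}. a ^ e i)"
      using N by (intro prod_sum_PiE[symmetric]) auto
    moreover have "int p dvd (\<Prod>i\<in>N. \<Sum>a\<in>{0..<int p}. a ^ e i)"
      using power_sum_dvd[OF p i(2)] dvd_prodI[OF N i(1)] dvd_trans by metis
    ultimately show ?case by (simp add: sum_distrib_left[symmetric])
  next
    case (add d f g)
    then show ?case by (simp add: distrib_right sum.distrib)
  next
    case (coord i d f)
    have "int p dvd (\<Sum>x\<in>cube p N. f x * (\<Prod>j\<in>N. x j ^ (e(i := Suc (e i))) j))"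
    proof (rule coord.IH)
      have "(\<Sum>j\<in>N. (e(i := Suc (e i))) j) = Suc (\<Sum>j\<in>N. e j)"
        using N coord.hyps(1) by (simp add: sum.remove[of N i])
      then show "d + (\<Sum>j\<in>N. (e(i := Suc (e i))) j) < card N * (p - 1)" using coord.prems by simp
    qed
    moreover have "(\<Prod>j\<in>N. x j ^ (e(i := Suc (e i))) j) = x i * (\<Prod>j\<in>N. x j ^ e j)" for x :: "'a \<Rightarrow> int"
      using N coord.hyps(1) by (simp add: prod.remove[of N i] mult_ac)
    ultimately show ?case by (simp add: mult_ac)
  qed
  from this[OF f, of "\<lambda>_. 0"] d show ?thesis by simp
qed

text \<open>For prime \<open>p\<close> and \<open>size Q = card N * (p - 1)\<close> this is, modulo
  \<open>p\<close> and up to sign, the coefficient of the monomial with all exponents equal to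
  \<open>p - 1\<close>. Its being nonzero is the invariant of the exchange argument.\<close>

definition cube_sum :: "nat \<Rightarrow> 'n set \<Rightarrow> ('l \<Rightarrow> 'n \<Rightarrow> int) \<Rightarrow> 'l multiset \<Rightarrow> int" where
  "cube_sum p N \<phi> Q = (\<Sum>x\<in>cube p N. \<Prod>l\<in>#Q. lin N (\<phi> l) x)"

lemma cong_prod_mset: "(\<And>l. l \<in># Q \<Longrightarrow> [f l = g l] (mod m)) \<Longrightarrow> [(\<Prod>l\<in>#Q. f l) = (\<Prod>l\<in>#Q. g l)] (mod (m::int))"
  by (induction Q) (auto intro: cong_mult)

lemma cube_translate:
  assumes p: "p > 0" and N: "finite N"
    and f: "\<And>x y. (\<And>i. i \<in> N \<Longrightarrow> [x i = y i] (mod int p)) \<Longrightarrow> [f x = f y] (mod int p)"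
  shows "[(\<Sum>x\<in>cube p N. f (\<lambda>i. x i + v i)) = (\<Sum>x\<in>cube p N. f x)] (mod int p)"
proof -
  let ?T = "\<lambda>v x. restrict (\<lambda>i. (x i + v i) mod int p) N"
  have "(\<Sum>x\<in>cube p N. f (?T v x)) = (\<Sum>x\<in>cube p N. f x)"
  proof (rule sum.reindex_bij_witness[of _ "?T (\<lambda>i. - v i)" "?T v"])
    fix x assume "x \<in> cube p N"
    then have "\<And>i. i \<in> N \<Longrightarrow> 0 \<le> x i \<and> x i < int p" "\<And>i. i \<notin> N \<Longrightarrow> x i = undefined"
      by (auto simp: PiE_iff extensional_def)
    then show "?T (\<lambda>i. - v i) (?T v x) = x" "?T v (?T (\<lambda>i. - v i) x) = x"
      by (simp_all add: fun_eq_iff mod_simps)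
  qed (use p in auto)
  moreover have "[(\<Sum>x\<in>cube p N. f (\<lambda>i. x i + v i)) = (\<Sum>x\<in>cube p N. f (?T v x))] (mod int p)"
    by (intro cong_sum f) (auto simp: cong_def)
  ultimately show ?thesis by simp
qed

lemma sum_mset_sum_swap:
  fixes f :: "'a \<Rightarrow> 'b \<Rightarrow> 'c::comm_monoid_add"
  shows "(\<Sum>x\<in>A. \<Sum>l\<in>#Q. f x l) = (\<Sum>l\<in>#Q. \<Sum>x\<in>A. f x l)"
  by (induction Q) (simp_all add: sum.distrib)

text \<open>Sum the Taylor expansion of the product at \<open>x + v\<close> over the cube: the left-hand side is translation invariant,
  and all terms of order at least two have too small a degree to contribute.\<close>
lemma cube_sum_derivative:
  assumes p: "Factorial_Ring.prime p" and N: "finite N" "N \<noteq> {}" and Q: "size Q = Suc (card N * (p - 1))"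
  shows "int p dvd (\<Sum>l\<in>#Q. lin N (\<phi> l) v * cube_sum p N \<phi> (Q - {#l#}))"
proof -
  have p1: "card N * (p - 1) > 0" using N prime_gt_1_nat[OF p] by (simp add: card_gt_0_iff)
  then obtain d where d: "card N * (p - 1) = Suc d" using gr0_implies_Suc by blast
  define P where "P x = (\<Prod>l\<in>#Q. lin N (\<phi> l) x)" for x
  define D where "D x = (\<Sum>l\<in>#Q. lin N (\<phi> l) v * (\<Prod>k\<in>#Q - {#l#}. lin N (\<phi> k) x))" for x
  have "poly_deg N d (\<lambda>x. P (\<lambda>i. x i + v i) - P x - D x)"
    unfolding P_def D_def lin_add by (rule poly_deg_prod_shift) (use d Q in simp)
  then have "int p dvd (\<Sum>x\<in>cube p N. P (\<lambda>i. x i + v i) - P x - D x)"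
    by (rule poly_deg_sum_cube[OF p N(1)]) (use d in simp)
  then have 1: "int p dvd (\<Sum>x\<in>cube p N. P (\<lambda>i. x i + v i)) - (\<Sum>x\<in>cube p N. P x) - (\<Sum>x\<in>cube p N. D x)"
    by (simp only: sum_subtractf)
  have "[P x = P y] (mod int p)" if "\<And>i. i \<in> N \<Longrightarrow> [x i = y i] (mod int p)" for x y
    unfolding P_def by (intro cong_prod_mset lin_cong that)
  then have "[(\<Sum>x\<in>cube p N. P (\<lambda>i. x i + v i)) = (\<Sum>x\<in>cube p N. P x)] (mod int p)"
    by (intro cube_translate N prime_gt_0_nat[OF p]) auto
  then have "int p dvd (\<Sum>x\<in>cube p N. P (\<lambda>i. x i + v i)) - (\<Sum>x\<in>cube p N. P x)"
    by (simp only: cong_iff_dvd_diff)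
  with 1 have "int p dvd (\<Sum>x\<in>cube p N. D x)"
    by (simp only: dvd_diff_right_iff)
  then show ?thesis
    unfolding D_def cube_sum_def sum_distrib_left by (simp only: sum_mset_sum_swap)
qed

section \<open>Exchanging factors\<close>

text \<open>For use with \<open>cube_sum_derivative\<close> when only one form \<open>i\<close>
  gives summands that survive modulo \<open>d\<close>; it contributes once for each of its
  copies.\<close>

lemma dvd_sum_mset_count:
  fixes f :: "'a \<Rightarrow> int"
  assumes "\<And>l. l \<in># Q \<Longrightarrow> l \<noteq> i \<Longrightarrow> d dvd f l"
  shows "d dvd (\<Sum>l\<in>#Q. f l) \<longleftrightarrow> d dvd int (count Q i) * f i"
proof -
  have "d dvd (\<Sum>l\<in>#Q. f l) - int (count Q i) * f i"
    using assms
  proof (induction Q)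
    case (add l Q)
    have IH: "d dvd (\<Sum>l\<in>#Q. f l) - int (count Q i) * f i" by (rule add.IH) (use add.prems in auto)
    show ?case
    proof (cases "l = i")
      case True
      then show ?thesis using IH by (simp add: algebra_simps)
    next
      case False
      then have "d dvd f l" using add.prems by auto
      from dvd_add[OF this IH] show ?thesis using False by (simp add: algebra_simps)
    qed
  qed simp
  then show ?thesis by (metis diff_add_cancel dvd_add_right_iff)
qed

lemma size_eq_sum_count: "finite I \<Longrightarrow> set_mset Z \<subseteq> I \<Longrightarrow> size Z = (\<Sum>i\<in>I. count Z i)"
  unfolding size_multiset_overloaded_eq by (rule sum.mono_neutral_left) (auto simp: not_in_iff)

text \<open>Among the sets \<open>\<beta>\<close> of factors that can be exchanged for further copies of forms from \<open>I\<close>, take one of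
  maximal size, and then \<open>Z'\<close> of maximal total label \<open>w\<close>. The forms of \<open>I\<close> that still lack copies turn out
  to be at most \<open>card \<beta>\<close> many: otherwise some \<open>u\<close> is annihilated by \<open>\<beta>\<close> and by the saturated forms of \<open>I\<close>, but
  not by all of \<open>I\<close>, and \<open>cube_sum_derivative\<close> in direction \<open>u\<close>, where by maximality a single summand
  survives, gives a contradiction.\<close>
lemma insertion_round:
  assumes p: "Factorial_Ring.prime p" and N: "finite N" "N \<noteq> {}" and I: "finite I" and m: "m < p"
    and indep: "\<And>\<tau>. \<exists>v. \<forall>i\<in>I. [lin N (\<phi> i) v = \<tau> i] (mod int p)"
    and disj: "set_mset P \<inter> I = {}"
    and size: "size (P + Z) = card N * (p - 1)"
    and nz: "\<not> int p dvd cube_sum p N \<phi> (P + Z)"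
    and Z: "set_mset Z \<subseteq> I" "\<And>i. count Z i \<le> m"
  obtains P' Z' where "P' \<subseteq># P" "\<And>l. count P l \<le> Suc (count P' l)"
    "size (P' + Z') = card N * (p - 1)" "\<not> int p dvd cube_sum p N \<phi> (P' + Z')"
    "set_mset Z' \<subseteq> I" "\<And>i. count Z' i \<le> m"
    "size Z \<le> size Z'" "m * card I - size Z' \<le> m * (size Z' - size Z)"
proof -
  \<comment> \<open>A state reachable from \<open>P + Z\<close>: since \<beta> is a set, every
    factor of \<open>P\<close> loses at most one copy, while \<open>Z\<close> may be replaced by any
    admissible multiset of the right size.\<close>
  define good where "good \<beta> Z' \<longleftrightarrow> \<beta> \<subseteq> set_mset P \<and> set_mset Z' \<subseteq> I \<and> (\<forall>i. count Z' i \<le> m) \<and>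
    size (P - mset_set \<beta> + Z') = card N * (p - 1) \<and>
    \<not> int p dvd cube_sum p N \<phi> (P - mset_set \<beta> + Z')" for \<beta> Z'
  have good0: "good {} Z" using size nz Z by (simp add: good_def)
  have "\<exists>\<beta>. (\<exists>Z'. good \<beta> Z') \<and> (\<forall>\<beta>'. (\<exists>Z'. good \<beta>' Z') \<longrightarrow> card \<beta>' \<le> card \<beta>)"
  proof (rule ex_has_greatest_nat[of "\<lambda>\<beta>. \<exists>Z'. good \<beta> Z'" "{}" card "Suc (card (set_mset P))"])
    show "\<forall>\<beta>. (\<exists>Z'. good \<beta> Z') \<longrightarrow> card \<beta> < Suc (card (set_mset P))"
      by (auto simp: good_def less_Suc_eq_le intro: card_mono)
  qed (use good0 in blast)
  then obtain \<beta> Z0 where \<beta>0: "good \<beta> Z0" and max\<beta>: "\<And>\<beta>' Z'. good \<beta>' Z' \<Longrightarrow> card \<beta>' \<le> card \<beta>"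
    by blast
  \<comment> \<open>Any injective labelling will do. It orients the exchanges within
    \<open>I\<close>, so that swapping a form for one with a larger label contradicts
    maximality.\<close>
  obtain w :: "'b \<Rightarrow> nat" where w: "inj_on w I"
    using finite_imp_inj_to_nat_seg[OF I] by auto
  have "\<exists>Z'. good \<beta> Z' \<and> (\<forall>Y. good \<beta> Y \<longrightarrow> (\<Sum>i\<in>#Y. w i) \<le> (\<Sum>i\<in>#Z'. w i))"
  proof (rule ex_has_greatest_nat[of "good \<beta>" Z0 "\<lambda>Y. \<Sum>i\<in>#Y. w i" "Suc (card N * (p - 1) * Max (w ` I))"])
    show "\<forall>Y. good \<beta> Y \<longrightarrow> (\<Sum>i\<in>#Y. w i) < Suc (card N * (p - 1) * Max (w ` I))"
    proof (intro allI impI)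
      fix Y assume Y: "good \<beta> Y"
      then have "(\<Sum>i\<in>#Y. w i) \<le> (\<Sum>i\<in>#Y. Max (w ` I))"
        using I by (intro sum_mset_mono Max_ge) (auto simp: good_def)
      also have "\<dots> = size Y * Max (w ` I)" by simp
      also have "\<dots> \<le> card N * (p - 1) * Max (w ` I)" using Y by (intro mult_right_mono) (auto simp: good_def)
      finally show "(\<Sum>i\<in>#Y. w i) < Suc (card N * (p - 1) * Max (w ` I))" by simp
    qed
  qed (rule \<beta>0)
  then obtain Z' where Z': "good \<beta> Z'"
    and maxw: "\<And>Y. good \<beta> Y \<Longrightarrow> (\<Sum>i\<in>#Y. w i) \<le> (\<Sum>i\<in>#Z'. w i)" by auto
  define P' where "P' = P - mset_set \<beta>"
  define U where "U = {i\<in>I. count Z' i < m}"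
  have \<beta>: "\<beta> \<subseteq> set_mset P" "finite \<beta>" using Z' finite_subset by (auto simp: good_def)
  have U: "finite U" "U \<subseteq> I" using I by (auto simp: U_def)
  have subP: "mset_set \<beta> \<subseteq># P"
    using \<beta> by (auto simp: subseteq_mset_def count_mset_set')
  have key: False if u\<beta>: "\<And>l. l \<in> \<beta> \<Longrightarrow> int p dvd lin N (\<phi> l) u"
    and uI: "\<And>l. l \<in> I - U \<Longrightarrow> int p dvd lin N (\<phi> l) u"
    and uU: "\<exists>i\<in>U. \<not> int p dvd lin N (\<phi> i) u" for u
  proof -
    have "\<exists>i. (i \<in> U \<and> \<not> int p dvd lin N (\<phi> i) u) \<and>
      (\<forall>y. y \<in> U \<and> \<not> int p dvd lin N (\<phi> y) u \<longrightarrow> w y \<le> w i)"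
    proof -
      from uU obtain j where "j \<in> U \<and> \<not> int p dvd lin N (\<phi> j) u" by blast
      then show ?thesis using U by (intro ex_has_greatest_nat[of _ j w "Suc (Max (w ` U))"]) (auto simp: less_Suc_eq_le)
    qed
    then obtain i where i: "i \<in> U" "\<not> int p dvd lin N (\<phi> i) u"
      and imax: "\<And>y. y \<in> U \<Longrightarrow> \<not> int p dvd lin N (\<phi> y) u \<Longrightarrow> w y \<le> w i" by blast
    define Q where "Q = P' + add_mset i Z'"
    have iI: "i \<in> I" and im: "count Z' i < m" using i by (auto simp: U_def)
    have "i \<notin># P" using disj iI by auto
    then have iP': "count P' i = 0" by (simp add: P'_def not_in_iff)
    have sQ: "size Q = Suc (card N * (p - 1))" using Z' by (simp add: Q_def P'_def good_def)
    \<comment> \<open>Here \<open>i\<close> is the form of largest label in \<open>U\<close> not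
      annihilated by \<open>u\<close>, and one copy of it has been added. Removing \<open>l\<close>
      from \<open>P'\<close> would enlarge \<beta>, unless \<open>l\<close> lies in \<beta> and is
      annihilated. Removing \<open>l\<close> from \<open>Z'\<close> would raise the total label if
      \<open>w l < w i\<close>; otherwise \<open>l\<close> is saturated or comes after
      \<open>i\<close>, and is annihilated.\<close>
    have "int p dvd lin N (\<phi> l) u * cube_sum p N \<phi> (Q - {#l#})" if l: "l \<in># Q" "l \<noteq> i" for l
    proof (cases "l \<in># P'")
      case True
      then have lP: "l \<in># P" by (auto simp: P'_def dest: in_diffD)
      show ?thesis
      proof (cases "l \<in> \<beta>")
        case False
        have eq: "Q - {#l#} = P - mset_set (insert l \<beta>) + add_mset i Z'"
          by (rule multiset_eqI) (use True False \<beta>(2) l(2) in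
            \<open>auto simp: Q_def P'_def count_mset_set' simp flip: count_greater_zero_iff\<close>)
        have "\<not> good (insert l \<beta>) (add_mset i Z')"
          using max\<beta>[of "insert l \<beta>"] False \<beta>(2) by fastforce
        moreover have "size (Q - {#l#}) = card N * (p - 1)" using sQ l by (simp add: size_Diff_singleton)
        moreover have "\<forall>j. count (add_mset i Z') j \<le> m"
          using Z' im by (simp add: good_def)
        ultimately have "int p dvd cube_sum p N \<phi> (Q - {#l#})"
          using eq lP Z' iI im \<beta> unfolding good_def by auto
        then show ?thesis by simp
      qed (use u\<beta> in simp)
    next
      case False
      then have lZ: "l \<in># Z'" using l by (auto simp: Q_def)
      then have lI: "l \<in> I" using Z' by (auto simp: good_def)
      consider "l \<notin> U" | "l \<in> U" "w i < w l" | "w l < w i"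
        using w lI iI l(2) by (metis inj_on_eq_iff linorder_neqE_nat)
      then show ?thesis
      proof cases
        case 3
        have eq: "Q - {#l#} = P - mset_set \<beta> + (add_mset i Z' - {#l#})"
          using lZ l by (simp add: Q_def P'_def)
        have "(\<Sum>j\<in>#add_mset i Z' - {#l#}. w j) > (\<Sum>j\<in>#Z'. w j)"
        proof -
          have "Z' = add_mset l (Z' - {#l#})" using lZ by simp
          then have "(\<Sum>j\<in>#Z'. w j) = w l + (\<Sum>j\<in>#Z' - {#l#}. w j)"
            by (metis image_mset_add_mset sum_mset.add_mset)
          moreover have "add_mset i Z' - {#l#} = add_mset i (Z' - {#l#})" using lZ l by simp
          ultimately show ?thesis using 3 by simp
        qed
        then have "\<not> good \<beta> (add_mset i Z' - {#l#})" using maxw by fastforce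
        moreover have "size (Q - {#l#}) = card N * (p - 1)" using sQ l by (simp add: size_Diff_singleton)
        moreover have "count (add_mset i Z' - {#l#}) j \<le> m" for j
          using Z' im by (auto simp: good_def intro: le_trans[OF diff_le_self])
        moreover have "set_mset (add_mset i Z' - {#l#}) \<subseteq> I"
          using Z' iI by (auto simp: good_def dest!: in_diffD)
        ultimately have "int p dvd cube_sum p N \<phi> (Q - {#l#})"
          using eq \<beta> unfolding good_def by auto
        then show ?thesis by simp
      qed (use uI lI imax in force)+
    qed
    then have "int p dvd int (count Q i) * (lin N (\<phi> i) u * cube_sum p N \<phi> (Q - {#i#}))"
      using cube_sum_derivative[OF p N sQ, of \<phi> u] by (subst (asm) dvd_sum_mset_count[of _ i]) auto
    moreover have "Q - {#i#} = P' + Z'" by (simp add: Q_def)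
    moreover have "\<not> int p dvd cube_sum p N \<phi> (P' + Z')" using Z' by (simp add: good_def P'_def)
    \<comment> \<open>The multiplicity of \<open>i\<close> in \<open>Q\<close> is positive and at
      most \<open>m < p\<close>, because \<open>P'\<close> contains no form of
      \<open>I\<close>.\<close>
    moreover have "\<not> int p dvd int (count Q i)"
      using im m iP' zdvd_imp_le[of "int p" "int (count Q i)"] by (auto simp: Q_def)
    ultimately show False using i(2) p by (simp add: prime_dvd_mult_iff)
  qed
  have cardU: "card U \<le> card \<beta>"
  proof (rule ccontr)
    assume less: "\<not> card U \<le> card \<beta>"
    \<comment> \<open>Pigeonhole: by independence all \<open>p ^ card U\<close> value patterns on
      \<open>U\<close> occur at vectors that annihilate \<open>I - U\<close>. On \<beta> there are
      only \<open>p ^ card \<beta>\<close> patterns, so two of these vectors agree there; their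
      difference is the \<open>u\<close> for \<open>key\<close>.\<close>
    have "\<forall>\<tau>. \<exists>v. \<forall>i\<in>I. [lin N (\<phi> i) v = (if i \<in> U then \<tau> i else 0)] (mod int p)"
      by (intro allI indep)
    then obtain v where v: "\<And>\<tau> i. i \<in> I \<Longrightarrow> [lin N (\<phi> i) (v \<tau>) = (if i \<in> U then \<tau> i else 0)] (mod int p)"
      by metis
    define g where "g \<tau> = restrict (\<lambda>l. lin N (\<phi> l) (v \<tau>) mod int p) \<beta>" for \<tau>
    have "g ` cube p U \<subseteq> cube p \<beta>"
      using prime_gt_0_nat[OF p] by (auto simp: g_def)
    moreover have "card (cube p \<beta>) < card (cube p U)"
      using less U \<beta> prime_gt_1_nat[OF p] by (simp add: card_PiE)
    moreover have "finite (cube p \<beta>)" using \<beta> by (intro finite_PiE) auto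
    ultimately have "\<not> inj_on g (cube p U)" by (meson card_inj_on_le not_le)
    then obtain \<tau> \<tau>' where \<tau>: "\<tau> \<in> cube p U" "\<tau>' \<in> cube p U" "\<tau> \<noteq> \<tau>'" "g \<tau> = g \<tau>'"
      by (auto simp: inj_on_def)
    then obtain i where i: "i \<in> U" "\<tau> i \<noteq> \<tau>' i" by (metis PiE_ext)
    show False
    proof (rule key[of "\<lambda>i. v \<tau> i - v \<tau>' i"])
      fix l assume "l \<in> \<beta>"
      then have "lin N (\<phi> l) (v \<tau>) mod int p = lin N (\<phi> l) (v \<tau>') mod int p"
        using fun_cong[OF \<tau>(4), of l] by (simp add: g_def)
      then show "int p dvd lin N (\<phi> l) (\<lambda>i. v \<tau> i - v \<tau>' i)"
        by (simp add: lin_diff mod_eq_dvd_iff)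
    next
      fix l assume "l \<in> I - U"
      then have "[lin N (\<phi> l) (v \<tau>) - lin N (\<phi> l) (v \<tau>') = 0 - 0] (mod int p)"
        using v[of l] by (intro cong_diff) auto
      then show "int p dvd lin N (\<phi> l) (\<lambda>i. v \<tau> i - v \<tau>' i)"
        by (simp add: lin_diff cong_0_iff)
    next
      have "[lin N (\<phi> i) (v \<tau>) - lin N (\<phi> i) (v \<tau>') = \<tau> i - \<tau>' i] (mod int p)"
        using v[of i] i U by (intro cong_diff) auto
      moreover have "\<not> int p dvd \<tau> i - \<tau>' i"
      proof -
        have "\<tau> i \<in> {0..<int p}" "\<tau>' i \<in> {0..<int p}" using \<tau> i by (auto simp: PiE_iff)
        then have "\<tau> i mod int p \<noteq> \<tau>' i mod int p" using i by simp
        then show ?thesis by (simp add: mod_eq_dvd_iff)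
      qed
      ultimately show "\<exists>i\<in>U. \<not> int p dvd lin N (\<phi> i) (\<lambda>i. v \<tau> i - v \<tau>' i)"
        using i by (metis lin_diff cong_dvd_iff)
    qed
  qed
  have sP': "size P' + card \<beta> = size P"
    using subP \<beta> size_mset_mono[OF subP] by (simp add: P'_def size_Diff_submset)
  moreover have "size P' + size Z' = size P + size Z" using Z' size by (simp add: P'_def good_def)
  ultimately have sZ: "size Z' = size Z + card \<beta>" by simp
  \<comment> \<open>Each unsaturated form lacks at most \<open>m\<close> copies and there are at
    most \<open>card \<beta>\<close> of them, while \<open>card \<beta>\<close> is exactly the
    number of copies gained in the round.\<close>
  have "m * card I = (\<Sum>i\<in>I. m)" by simp
  also have "\<dots> = (\<Sum>i\<in>I. count Z' i) + (\<Sum>i\<in>I. m - count Z' i)"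
    using Z' by (simp add: sum.distrib[symmetric] good_def)
  also have "(\<Sum>i\<in>I. count Z' i) = size Z'"
    using size_eq_sum_count[OF I] Z' by (simp add: good_def)
  also have "(\<Sum>i\<in>I. m - count Z' i) = (\<Sum>i\<in>U. m - count Z' i)"
    using I by (intro sum.mono_neutral_right) (auto simp: U_def)
  also have "\<dots> \<le> m * card U" using sum_bounded_above[of U "\<lambda>i. m - count Z' i" m] by (simp add: mult.commute)
  also have "\<dots> \<le> m * card \<beta>" using cardU by simp
  finally have "m * card I - size Z' \<le> m * (size Z' - size Z)" using sZ by simp
  moreover have "count P l \<le> Suc (count P' l)" for l
    by (auto simp: P'_def count_mset_set')
  ultimately show ?thesis
    using that[of P' Z'] Z' sZ by (auto simp: good_def P'_def)
qed

text \<open>This is \<open>(1 + 1 / m) ^ m \<ge> 2\<close>, which turns \<open>m\<close> rounds of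
  exchange into a halving. The auxiliary claim is Bernoulli's inequality with denominators
  cleared.\<close>

lemma two_mult_power_le:
  assumes "0 < (m :: nat)"
  shows "2 * m ^ m \<le> (m + 1) ^ m"
proof -
  have "m ^ n * (m + n) \<le> (m + 1) ^ n * m" for n
  proof (induction n)
    case (Suc n)
    have "m ^ Suc n * (m + Suc n) \<le> (m ^ n * (m + n)) * (m + 1)"
      by (simp add: algebra_simps)
    also have "\<dots> \<le> ((m + 1) ^ n * m) * (m + 1)" using Suc by (rule mult_right_mono) simp
    finally show ?case by (simp add: algebra_simps)
  qed simp
  from this[of m] have "m ^ m * (m + m) \<le> (m + 1) ^ m * m" .
  moreover have "m ^ m * (m + m) = m * (2 * m ^ m)" by simp
  ultimately have "m * (2 * m ^ m) \<le> m * (m + 1) ^ m" by (metis mult.commute)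
  then show ?thesis using assms unfolding mult_le_cancel1 by blast
qed

text \<open>If \<open>a\<close> copies are missing before a round and \<open>a'\<close> after it,
  then \<open>a' \<le> m * (a - a')\<close>, that is, \<open>(m + 1) * a' \<le> m * a\<close>.
  Iterating gives a geometric decay of what is missing.\<close>

lemma insertion_rounds:
  assumes p: "Factorial_Ring.prime p" and N: "finite N" "N \<noteq> {}" and I: "finite I" and m: "m < p"
    and indep: "\<And>\<tau>. \<exists>v. \<forall>i\<in>I. [lin N (\<phi> i) v = \<tau> i] (mod int p)"
    and disj: "set_mset P \<inter> I = {}"
    and size: "size P = card N * (p - 1)"
    and nz: "\<not> int p dvd cube_sum p N \<phi> P"
  shows "\<exists>P' Z. P' \<subseteq># P \<and> (\<forall>l. count P l \<le> count P' l + r) \<and>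
    size (P' + Z) = card N * (p - 1) \<and> \<not> int p dvd cube_sum p N \<phi> (P' + Z) \<and>
    set_mset Z \<subseteq> I \<and> (\<forall>i. count Z i \<le> m) \<and>
    (m * card I - size Z) * (m + 1) ^ r \<le> m * card I * m ^ r"
proof (induction r)
  case 0
  then show ?case using size nz by (intro exI[of _ P] exI[of _ "{#}"]) auto
next
  case (Suc r)
  then obtain P1 Z1 where 1: "P1 \<subseteq># P" "\<And>l. count P l \<le> count P1 l + r"
    "size (P1 + Z1) = card N * (p - 1)" "\<not> int p dvd cube_sum p N \<phi> (P1 + Z1)"
    "set_mset Z1 \<subseteq> I" "\<And>i. count Z1 i \<le> m"
    "(m * card I - size Z1) * (m + 1) ^ r \<le> m * card I * m ^ r" by blast
  have "set_mset P1 \<inter> I = {}" using disj set_mset_mono[OF 1(1)] by blast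
  from insertion_round[OF p N I m indep this 1(3-6)] obtain P2 Z2 where
    2: "P2 \<subseteq># P1" "\<And>l. count P1 l \<le> Suc (count P2 l)"
    "size (P2 + Z2) = card N * (p - 1)" "\<not> int p dvd cube_sum p N \<phi> (P2 + Z2)"
    "set_mset Z2 \<subseteq> I" "\<And>i. count Z2 i \<le> m"
    "size Z1 \<le> size Z2" "m * card I - size Z2 \<le> m * (size Z2 - size Z1)" by blast
  have le: "size Z2 \<le> m * card I"
    using size_eq_sum_count[OF I 2(5)] sum_bounded_above[of I "count Z2" m] 2(6) by (simp add: mult.commute)
  have "(m * card I - size Z2) * (m + 1) \<le> m * (m * card I - size Z1)"
  proof -
    have "m * card I - size Z1 = (m * card I - size Z2) + (size Z2 - size Z1)" using le 2(7) by simp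
    then show ?thesis using 2(8) by (simp add: algebra_simps)
  qed
  then have "(m * card I - size Z2) * (m + 1) * (m + 1) ^ r \<le> m * (m * card I - size Z1) * (m + 1) ^ r"
    by (rule mult_right_mono) simp
  also have "\<dots> \<le> m * (m * card I * m ^ r)" using mult_left_mono[OF 1(7), of m] by (simp add: mult.assoc)
  finally have "(m * card I - size Z2) * (m + 1) ^ Suc r \<le> m * card I * m ^ Suc r"
    by (simp only: mult_ac power_Suc)
  moreover have "count P l \<le> count P2 l + Suc r" for l using 1(2)[of l] 2(2)[of l] by simp
  ultimately show ?case using 2 subset_mset.order_trans[OF 2(1) 1(1)] by blast
qed

text \<open>After \<open>m * h\<close> rounds the number of missing copies has shrunk by the factor
  \<open>2 ^ h\<close>. It started below \<open>2 ^ h\<close>, so it is now zero.\<close>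

lemma insertion_block:
  assumes p: "Factorial_Ring.prime p" and N: "finite N" "N \<noteq> {}" and I: "finite I" and m: "0 < m" "m < p"
    and indep: "\<And>\<tau>. \<exists>v. \<forall>i\<in>I. [lin N (\<phi> i) v = \<tau> i] (mod int p)"
    and disj: "set_mset P \<inter> I = {}"
    and size: "size P = card N * (p - 1)"
    and nz: "\<not> int p dvd cube_sum p N \<phi> P"
    and h: "m * card I < 2 ^ h"
  obtains P' Z where "P' \<subseteq># P" "\<And>l. count P l \<le> count P' l + m * h"
    "size (P' + Z) = card N * (p - 1)" "\<not> int p dvd cube_sum p N \<phi> (P' + Z)"
    "set_mset Z \<subseteq> I" "\<And>i. i \<in> I \<Longrightarrow> count Z i = m"
proof -
  from insertion_rounds[OF p N I m(2) indep disj size nz, of "m * h"] obtain P' Z where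
    P': "P' \<subseteq># P" "\<And>l. count P l \<le> count P' l + m * h"
    "size (P' + Z) = card N * (p - 1)" "\<not> int p dvd cube_sum p N \<phi> (P' + Z)"
    "set_mset Z \<subseteq> I" "\<And>i. count Z i \<le> m"
    "(m * card I - size Z) * (m + 1) ^ (m * h) \<le> m * card I * m ^ (m * h)" by blast
  have "(2 * m ^ m) ^ h \<le> ((m + 1) ^ m) ^ h" using m(1) by (intro power_mono two_mult_power_le) simp_all
  then have "2 ^ h * m ^ (m * h) \<le> (m + 1) ^ (m * h)" by (simp add: power_mult power_mult_distrib)
  then have "(m * card I - size Z) * (2 ^ h * m ^ (m * h)) \<le> (m * card I - size Z) * (m + 1) ^ (m * h)"
    by (rule mult_left_mono) simp
  also note P'(7)
  finally have "((m * card I - size Z) * 2 ^ h) * m ^ (m * h) \<le> (m * card I) * m ^ (m * h)"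
    by (simp only: mult.assoc)
  then have "(m * card I - size Z) * 2 ^ h \<le> m * card I" using m(1) by simp
  also have "\<dots> < 2 ^ h" by (rule h)
  finally have "m * card I - size Z = 0" by simp
  \<comment> \<open>The total is full and no form has more than \<open>m\<close> copies, so each has
    exactly \<open>m\<close>.\<close>
  then have "(\<Sum>i\<in>I. m) \<le> (\<Sum>i\<in>I. count Z i)"
    using size_eq_sum_count[OF I P'(5)] by (simp add: mult.commute)
  then have "count Z i = m" if "i \<in> I" for i
    using that P'(6) sum_strict_mono_ex1[OF I, of "count Z" "\<lambda>_. m"]
    by (metis antisym_conv3 linorder_not_le order_le_less)
  with P' show ?thesis using that by blast
qed

text \<open>Inserting a family with multiplicity \<open>m\<close> costs each earlier form at most
  \<open>m * h\<close> copies. If those had \<open>(h + 1) * m\<close> copies, then \<open>m\<close>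
  of them survive, which is why the guaranteed multiplicity falls by the factor \<open>h + 1\<close>
  per family.\<close>

lemma insertion_blocks:
  fixes E :: "'l set"
  assumes p: "Factorial_Ring.prime p" and N: "finite N" "N \<noteq> {}" and E: "finite E"
    and indep: "\<And>s \<tau>. s < t \<Longrightarrow> \<exists>v. \<forall>l\<in>E. c l = s \<longrightarrow> [lin N (\<phi> l) v = \<tau> l] (mod int p)"
    and disj: "set_mset P \<inter> E = {}"
    and size: "size P = card N * (p - 1)"
    and nz: "\<not> int p dvd cube_sum p N \<phi> P"
    and G: "(h + 1) ^ (t - 1) < p" "(h + 1) ^ (t - 1) * card E < 2 ^ h"
    and s: "s \<le> t"
  shows "\<exists>P'. size P' = card N * (p - 1) \<and> \<not> int p dvd cube_sum p N \<phi> P' \<and>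
    set_mset P' \<subseteq> set_mset P \<union> {l\<in>E. c l < s} \<and>
    (\<forall>l\<in>E. c l < s \<longrightarrow> (h + 1) ^ (t - s) \<le> count P' l)"
  using s
proof (induction s)
  case 0
  then show ?case using size nz by (intro exI[of _ P]) auto
next
  case (Suc s)
  then obtain P1 where P1: "size P1 = card N * (p - 1)" "\<not> int p dvd cube_sum p N \<phi> P1"
    "set_mset P1 \<subseteq> set_mset P \<union> {l\<in>E. c l < s}"
    "\<And>l. l \<in> E \<Longrightarrow> c l < s \<Longrightarrow> (h + 1) ^ (t - s) \<le> count P1 l" by auto
  define I where "I = {l\<in>E. c l = s}"
  define m where "m = (h + 1) ^ (t - Suc s)"
  have mle: "m \<le> (h + 1) ^ (t - 1)" unfolding m_def by (intro power_increasing) auto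
  have "m * card I \<le> (h + 1) ^ (t - 1) * card E"
    using mle E by (intro mult_mono card_mono) (auto simp: I_def)
  then have mh: "m * card I < 2 ^ h" using G by simp
  have indepI: "\<exists>v. \<forall>i\<in>I. [lin N (\<phi> i) v = \<tau> i] (mod int p)" for \<tau>
    using indep[of s \<tau>] Suc.prems by (auto simp: I_def)
  have disjI: "set_mset P1 \<inter> I = {}" using P1(3) disj by (auto simp: I_def)
  have I: "finite I" using E by (simp add: I_def)
  have m: "0 < m" "m < p" using mle G by (auto simp: m_def)
  from insertion_block[OF p N I m indepI disjI P1(1,2) mh] obtain P2 Z where
    P2: "P2 \<subseteq># P1" "\<And>l. count P1 l \<le> count P2 l + m * h"
    "size (P2 + Z) = card N * (p - 1)" "\<not> int p dvd cube_sum p N \<phi> (P2 + Z)"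
    "set_mset Z \<subseteq> I" "\<And>i. i \<in> I \<Longrightarrow> count Z i = m" by blast
  have "set_mset (P2 + Z) \<subseteq> set_mset P \<union> {l\<in>E. c l < Suc s}"
    using P2(5) P1(3) set_mset_mono[OF P2(1)] by (auto simp: I_def)
  moreover have "m \<le> count (P2 + Z) l" if l: "l \<in> E" "c l < Suc s" for l
  proof (cases "c l = s")
    case False
    have "(h + 1) ^ (t - s) = m * h + m"
    proof -
      have "t - s = Suc (t - Suc s)" using Suc.prems by simp
      then show ?thesis by (simp add: m_def)
    qed
    then show ?thesis using P1(4)[of l] P2(2)[of l] l False by simp
  qed (use P2(6) l in \<open>simp add: I_def\<close>)
  ultimately show ?case using P2(3,4) unfolding m_def by blast
qed

text \<open>The starting point of the exchange. The sum factors over the coordinates, and by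
  Fermat's theorem each factor is congruent to \<open>p - 1\<close>.\<close>

lemma cube_sum_coordinates:
  assumes p: "Factorial_Ring.prime p" and N: "finite N"
    and \<phi>: "\<And>i x. i \<in> N \<Longrightarrow> lin N (\<phi> (f i)) x = x i"
  shows "\<not> int p dvd cube_sum p N \<phi> (\<Sum>i\<in>N. replicate_mset (p - 1) (f i))"
proof -
  have "(\<Prod>l\<in>#(\<Sum>i\<in>N'. replicate_mset (p - 1) (f i)). lin N (\<phi> l) x) = (\<Prod>i\<in>N'. x i ^ (p - 1))"
    if "N' \<subseteq> N" for N' x
    using finite_subset[OF that N] that by (induction N' rule: finite_induct) (auto simp: \<phi>)
  then have "cube_sum p N \<phi> (\<Sum>i\<in>N. replicate_mset (p - 1) (f i)) = (\<Sum>x\<in>cube p N. \<Prod>i\<in>N. x i ^ (p - 1))"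
    by (simp add: cube_sum_def)
  also have "\<dots> = (\<Prod>i\<in>N. \<Sum>a\<in>{0..<int p}. a ^ (p - 1))"
    using N by (intro prod_sum_PiE[symmetric]) auto
  finally have eq: "cube_sum p N \<phi> (\<Sum>i\<in>N. replicate_mset (p - 1) (f i)) = (\<Sum>a\<in>{0..<int p}. a ^ (p - 1)) ^ card N"
    by simp
  have "[a ^ (p - 1) = (if a = 0 then 0 else 1)] (mod int p)" if a: "a \<in> {0..<int p}" for a
  proof (cases "a = 0")
    case False
    then have "\<not> p dvd nat a" using a nat_dvd_not_less[of "nat a" p] nat_less_iff[of a p] by auto
    from fermat_theorem[OF p this] have "[int (nat a ^ (p - 1)) = int 1] (mod int p)"
      by (simp only: cong_int_iff)
    then show ?thesis using a False by simp
  qed (use prime_gt_1_nat[OF p] in \<open>simp add: power_0_left\<close>)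
  then have "[(\<Sum>a\<in>{0..<int p}. a ^ (p - 1)) = (\<Sum>a\<in>{0..<int p}. if a = 0 then 0 else 1)] (mod int p)"
    by (intro cong_sum)
  moreover have "(\<Sum>a\<in>{0..<int p}. if a = 0 then 0 else (1::int)) = int p - 1"
  proof -
    have "(\<Sum>a\<in>{0..<int p}. if a = 0 then 0 else (1::int)) = (\<Sum>a\<in>{0..<int p}. 1 - (if a = 0 then 1 else 0))"
      by (intro sum.cong) auto
    then show ?thesis using prime_gt_0_nat[OF p] by (simp add: sum_subtractf)
  qed
  ultimately have "[(\<Sum>a\<in>{0..<int p}. a ^ (p - 1)) = int p - 1] (mod int p)" by simp
  then have "int p dvd (\<Sum>a\<in>{0..<int p}. a ^ (p - 1)) \<longleftrightarrow> int p dvd int p - 1" by (rule cong_dvd_iff)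
  also have "\<not> int p dvd int p - 1" using prime_gt_1_nat[OF p] zdvd_imp_le[of "int p" "int p - 1"] by auto
  finally show ?thesis unfolding eq using p by (metis prime_dvd_power prime_nat_int_transfer)
qed

lemma avoid_hyperplanes:
  fixes \<phi> :: "'j \<Rightarrow> 'n \<Rightarrow> int"
  assumes p: "Factorial_Ring.prime p" and N: "finite N" "N \<noteq> {}" and E: "finite E"
    and indep: "\<And>s \<tau>. s < t \<Longrightarrow> \<exists>v. \<forall>j\<in>E. c j = s \<longrightarrow> [lin N (\<phi> j) v = \<tau> j] (mod int p)"
    and c: "\<And>j. j \<in> E \<Longrightarrow> c j < t"
    and G: "(h + 1) ^ (t - 1) < p" "(h + 1) ^ (t - 1) * card E < 2 ^ h"
  obtains x where "x \<in> cube p N" "\<And>j. j \<in> E \<Longrightarrow> \<not> [lin N (\<phi> j) x = a j] (mod int p)"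
proof -
  \<comment> \<open>The sum type keeps the coordinate forms of the starting product apart from the
    given forms as labels, even where both denote the same function.\<close>
  define \<psi> :: "'n + 'j \<Rightarrow> 'n \<Rightarrow> int" where "\<psi> = case_sum (\<lambda>i k. if k = i then 1 else 0) \<phi>"
  define P where "P = (\<Sum>i\<in>N. replicate_mset (p - 1) (Inl i :: 'n + 'j))"
  have "lin N (\<psi> (Inl i)) x = x i" if "i \<in> N" for i x
  proof -
    have "lin N (\<psi> (Inl i)) x = (\<Sum>k\<in>N. if k = i then x k else 0)"
      unfolding lin_def \<psi>_def by (intro sum.cong) auto
    then show ?thesis using N(1) that by simp
  qed
  then have nz: "\<not> int p dvd cube_sum p N \<psi> P"
    unfolding P_def by (rule cube_sum_coordinates[OF p N(1)])
  have size: "size P = card N * (p - 1)" by (simp add: P_def size_multiset_sum)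
  have sP: "set_mset P \<subseteq> range Inl"
    unfolding P_def by (induction N rule: infinite_finite_induct) (auto split: if_splits)
  have ind: "\<exists>v. \<forall>l\<in>Inr ` E. case_sum (\<lambda>_. 0) c l = s \<longrightarrow> [lin N (\<psi> l) v = \<tau> l] (mod int p)"
    if "s < t" for s \<tau>
  proof -
    obtain v where "\<forall>j\<in>E. c j = s \<longrightarrow> [lin N (\<phi> j) v = \<tau> (Inr j)] (mod int p)"
      using indep[OF \<open>s < t\<close>, of "\<lambda>j. \<tau> (Inr j)"] by blast
    then show ?thesis by (intro exI[of _ v]) (simp add: \<psi>_def)
  qed
  have dj: "set_mset P \<inter> Inr ` E = {}" using sP by auto
  have G2: "(h + 1) ^ (t - 1) * card (Inr ` E :: ('n + 'j) set) < 2 ^ h"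
    using G(2) by (simp add: card_image)
  have fin: "finite (Inr ` E :: ('n + 'j) set)" using E by simp
  have "\<exists>P'. size P' = card N * (p - 1) \<and> \<not> int p dvd cube_sum p N \<psi> P' \<and>
    set_mset P' \<subseteq> set_mset P \<union> {l \<in> Inr ` E. case_sum (\<lambda>_. 0) c l < t} \<and>
    (\<forall>l\<in>Inr ` E. case_sum (\<lambda>_. 0) c l < t \<longrightarrow> (h + 1) ^ (t - t) \<le> count P' l)"
    by (rule insertion_blocks[OF p N fin _ dj size nz G(1) G2 order_refl]) (rule ind)
  then obtain P' where
    P': "size P' = card N * (p - 1)" "\<not> int p dvd cube_sum p N \<psi> P'"
    and cnt: "\<forall>l\<in>Inr ` E. case_sum (\<lambda>_. 0) c l < t \<longrightarrow> (h + 1) ^ (t - t) \<le> count P' l"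
    by (elim exE conjE)
  have sub: "Inr j \<in># P'" if "j \<in> E" for j
  proof -
    have "1 \<le> count P' (Inr j)" using bspec[OF cnt imageI[OF that]] c[OF that] by simp
    then show ?thesis by (simp flip: count_greater_zero_iff)
  qed
  \<comment> \<open>The coordinate factors stay linear, while each given form has its forbidden
    value subtracted. This changes the product only in lower degree, so its sum over the cube
    remains nonzero modulo \<open>p\<close>, and so does the product at some point.\<close>
  define b :: "'n + 'j \<Rightarrow> int" where "b = case_sum (\<lambda>_. 0) a"
  have pos: "card N * (p - 1) > 0" using N prime_gt_1_nat[OF p] by (simp add: card_gt_0_iff)
  have deg: "poly_deg N (size P' - 1) (\<lambda>x. (\<Prod>l\<in>#P'. lin N (\<psi> l) x - b l) - (\<Prod>l\<in>#P'. lin N (\<psi> l) x))"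
    by (rule poly_deg_prod_affine) linarith
  have "size P' - 1 < card N * (p - 1)" using pos P'(1) by linarith
  then have "int p dvd (\<Sum>x\<in>cube p N. (\<Prod>l\<in>#P'. lin N (\<psi> l) x - b l) - (\<Prod>l\<in>#P'. lin N (\<psi> l) x))"
    by (rule poly_deg_sum_cube[OF p N(1) deg])
  then have diff: "int p dvd (\<Sum>x\<in>cube p N. \<Prod>l\<in>#P'. lin N (\<psi> l) x - b l) - cube_sum p N \<psi> P'"
    unfolding cube_sum_def sum_subtractf .
  have "\<exists>x\<in>cube p N. \<not> int p dvd (\<Prod>l\<in>#P'. lin N (\<psi> l) x - b l)"
  proof (rule ccontr)
    assume *: "\<not> ?thesis"
    have "int p dvd (\<Sum>x\<in>cube p N. \<Prod>l\<in>#P'. lin N (\<psi> l) x - b l)"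
      by (rule dvd_sum) (use * in blast)
    with diff have "int p dvd cube_sum p N \<psi> P'" by (simp only: dvd_diff_right_iff)
    with P'(2) show False ..
  qed
  then obtain x where x: "x \<in> cube p N" "\<not> int p dvd (\<Prod>l\<in>#P'. lin N (\<psi> l) x - b l)" ..
  have "\<not> [lin N (\<phi> j) x = a j] (mod int p)" if j: "j \<in> E" for j
  proof
    assume "[lin N (\<phi> j) x = a j] (mod int p)"
    then have "int p dvd lin N (\<psi> (Inr j)) x - b (Inr j)"
      by (simp add: \<psi>_def b_def cong_iff_dvd_diff)
    moreover have "lin N (\<psi> (Inr j)) x - b (Inr j) dvd (\<Prod>l\<in>#P'. lin N (\<psi> l) x - b l)"
      using sub[OF j] by (intro dvd_prod_mset) auto
    ultimately show False using x(2) dvd_trans by blast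
  qed
  with x(1) show ?thesis using that by blast
qed

section \<open>Matroid partition\<close>

text \<open>Rado's argument: start with all \<open>t\<close> classes allowed for every element and forbid classes as
  long as the rank condition survives. If neither of two classes can be forbidden for the same
  element, submodularity applied to the two violating sets gives a contradiction.\<close>
lemma matroid_partition:
  fixes r :: "'j set \<Rightarrow> nat"
  assumes E: "finite E"
    and mono: "\<And>A B. A \<subseteq> B \<Longrightarrow> B \<subseteq> E \<Longrightarrow> r A \<le> r B"
    and submod: "\<And>A B. A \<subseteq> E \<Longrightarrow> B \<subseteq> E \<Longrightarrow> r (A \<union> B) + r (A \<inter> B) \<le> r A + r B"
    and empty: "r {} = 0"
    and sparse: "\<And>S. S \<subseteq> E \<Longrightarrow> card S \<le> t * r S"
  obtains c where "\<And>j. j \<in> E \<Longrightarrow> c j < t" "\<And>s. card {j\<in>E. c j = s} \<le> r {j\<in>E. c j = s}"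
proof -
  \<comment> \<open>\<open>Y j\<close> is the set of classes still allowed for \<open>j\<close>. The
    condition in \<open>valid\<close> is that of Hall and Rado; when all classes are allowed,
    \<open>f Y S\<close> is \<open>t * r S\<close>.\<close>
  define f where "f Y S = (\<Sum>s<t. r {j\<in>S. s \<in> Y j})" for Y S
  define valid where "valid Y \<longleftrightarrow> (\<forall>j. Y j \<subseteq> {..<t}) \<and> (\<forall>S\<subseteq>E. card S \<le> f Y S)" for Y
  have "valid (\<lambda>_. {..<t})" using sparse by (simp add: valid_def f_def)
  then obtain Y where Y: "valid Y"
    and least: "\<And>Y'. valid Y' \<Longrightarrow> (\<Sum>j\<in>E. card (Y j)) \<le> (\<Sum>j\<in>E. card (Y' j))"
    using ex_has_least_nat[of valid "\<lambda>_. {..<t}" "\<lambda>Y. \<Sum>j\<in>E. card (Y j)"] by blast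
  have finY: "finite (Y j)" for j using Y finite_subset[of "Y j" "{..<t}"] by (auto simp: valid_def)
  have violate: "\<exists>S\<subseteq>E. j \<in> S \<and> f (Y(j := Y j - {s})) S < card S" if j: "j \<in> E" "s \<in> Y j" for j s
  proof -
    let ?Y = "Y(j := Y j - {s})"
    have "(\<Sum>i\<in>E. card (?Y i)) < (\<Sum>i\<in>E. card (Y i))"
    proof -
      have "0 < card (Y j)" using finY j by (auto simp: card_gt_0_iff)
      then show ?thesis
        using E j finY by (intro sum_strict_mono_ex1) (auto intro!: bexI[of _ j])
    qed
    then have "\<not> valid ?Y" using least by fastforce
    moreover have "\<forall>i. ?Y i \<subseteq> {..<t}" using Y by (auto simp: valid_def)
    ultimately obtain S where S: "S \<subseteq> E" "f ?Y S < card S" by (auto simp: valid_def not_le)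
    have "j \<in> S"
    proof (rule ccontr)
      assume "j \<notin> S"
      then have "{i\<in>S. s' \<in> ?Y i} = {i\<in>S. s' \<in> Y i}" for s' by auto
      then have "f ?Y S = f Y S" by (simp only: f_def)
      then show False using S Y by (auto simp: valid_def not_le[symmetric])
    qed
    with S show ?thesis by blast
  qed
  have unique: "s1 = s2" if j: "j \<in> E" and s: "s1 \<in> Y j" "s2 \<in> Y j" for j s1 s2
  proof (rule ccontr)
    assume ne: "s1 \<noteq> s2"
    let ?Y1 = "Y(j := Y j - {s1})" and ?Y2 = "Y(j := Y j - {s2})"
    obtain S1 where S1: "S1 \<subseteq> E" "j \<in> S1" "f ?Y1 S1 < card S1" using violate[OF j s(1)] by blast
    obtain S2 where S2: "S2 \<subseteq> E" "j \<in> S2" "f ?Y2 S2 < card S2" using violate[OF j s(2)] by blast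
    \<comment> \<open>As the two forbidden classes differ, each class allowed for \<open>j\<close>
      is still allowed in \<open>?Y1\<close> or \<open>?Y2\<close>, so the unions agree; the
      intersections can differ only at \<open>j\<close>.\<close>
    have "f Y (S1 \<union> S2) + f Y (S1 \<inter> S2 - {j}) \<le> f ?Y1 S1 + f ?Y2 S2"
      unfolding f_def sum.distrib[symmetric]
    proof (rule sum_mono)
      fix s
      let ?A = "{i\<in>S1. s \<in> ?Y1 i}" and ?B = "{i\<in>S2. s \<in> ?Y2 i}"
      have "{i\<in>S1 \<union> S2. s \<in> Y i} = ?A \<union> ?B" using ne S1 S2 by (auto split: if_splits)
      moreover have "r {i\<in>S1 \<inter> S2 - {j}. s \<in> Y i} \<le> r (?A \<inter> ?B)"
        using S1 by (intro mono) auto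
      moreover have "r (?A \<union> ?B) + r (?A \<inter> ?B) \<le> r ?A + r ?B"
        using S1 S2 by (intro submod) auto
      ultimately show "r {i\<in>S1 \<union> S2. s \<in> Y i} + r {i\<in>S1 \<inter> S2 - {j}. s \<in> Y i} \<le> r ?A + r ?B"
        by simp
    qed
    moreover have "card (S1 \<union> S2) \<le> f Y (S1 \<union> S2)" "card (S1 \<inter> S2 - {j}) \<le> f Y (S1 \<inter> S2 - {j})"
    proof -
      have "S1 \<union> S2 \<subseteq> E" "S1 \<inter> S2 - {j} \<subseteq> E" using S1 S2 by auto
      then show "card (S1 \<union> S2) \<le> f Y (S1 \<union> S2)" "card (S1 \<inter> S2 - {j}) \<le> f Y (S1 \<inter> S2 - {j})"
        using Y unfolding valid_def by blast+
    qed
    moreover have fin: "finite S1" "finite S2" using S1 S2 E finite_subset by auto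
    moreover have "card (S1 \<union> S2) + card (S1 \<inter> S2) = card S1 + card S2"
      using fin by (rule card_Un_Int[symmetric])
    moreover have "card (S1 \<inter> S2 - {j}) + 1 = card (S1 \<inter> S2)"
      using fin S1 S2 by (metis Int_iff One_nat_def Suc_eq_plus1 card.remove finite_Int)
    \<comment> \<open>Two strict inequalities make the right-hand side at most
      \<open>card S1 + card S2 - 2\<close>, but omitting \<open>j\<close> lowers the left-hand side
      only to \<open>card S1 + card S2 - 1\<close>.\<close>
    ultimately show False using S1(3) S2(3) by linarith
  qed
  have nonempty: "Y j \<noteq> {}" if j: "j \<in> E" for j
  proof
    assume "Y j = {}"
    then have "{i\<in>{j}. s \<in> Y i} = {}" for s by auto
    then have "f Y {j} = 0" by (simp only: f_def empty) simp
    moreover have "card {j} \<le> f Y {j}" using Y j unfolding valid_def by blast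
    ultimately show False by simp
  qed
  define c where "c j = (SOME s. s \<in> Y j)" for j
  have c: "c j \<in> Y j" if "j \<in> E" for j
    using nonempty[OF that] by (auto simp: c_def some_in_eq)
  have lt: "c j < t" if "j \<in> E" for j using c[OF that] Y by (auto simp: valid_def)
  have "card {j\<in>E. c j = s} \<le> r {j\<in>E. c j = s}" for s
  proof -
    let ?S = "{j\<in>E. c j = s}"
    have sub: "{j\<in>?S. s' \<in> Y j} = (if s' = s then ?S else {})" for s'
      using c unique by auto
    have "card ?S \<le> f Y ?S" using Y by (auto simp: valid_def)
    also have "\<dots> = (\<Sum>s'<t. if s' = s then r ?S else 0)"
      unfolding f_def sub by (intro sum.cong) (auto simp: empty)
    also have "\<dots> \<le> r ?S" by simp
    finally show ?thesis .
  qed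
  with lt show ?thesis using that by blast
qed

section \<open>Finite abelian groups\<close>

lemma card_fibres:
  assumes "finite A" "\<And>a. a \<in> A \<Longrightarrow> card {x\<in>A. f x = f a} = n"
  shows "card A = n * card (f ` A)"
proof -
  have "card A = (\<Sum>y\<in>f ` A. card {x\<in>A. f x = y})"
    unfolding card_eq_sum by (rule sum.image_gen[OF assms(1)])
  also have "\<dots> = (\<Sum>y\<in>f ` A. n)" using assms(2) by (intro sum.cong) auto
  finally show ?thesis by simp
qed

text \<open>The ambient \<open>D\<close> makes the empty intersection equal to \<open>D\<close>
  instead of the whole type.\<close>

definition Inter_in :: "'a set \<Rightarrow> ('j \<Rightarrow> 'a set) \<Rightarrow> 'j set \<Rightarrow> 'a set" where
  "Inter_in D H S = D \<inter> (\<Inter>j\<in>S. H j)"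

lemma Inter_in_empty [simp]: "Inter_in D H {} = D"
  by (simp add: Inter_in_def)

lemma Inter_in_Un: "Inter_in D H (S \<union> S') = Inter_in D H S \<inter> Inter_in D H S'"
  by (auto simp: Inter_in_def)

lemma Inter_in_insert: "Inter_in D H (insert j S) = Inter_in D H S \<inter> H j"
  by (auto simp: Inter_in_def)

lemma Inter_in_antimono: "S \<subseteq> S' \<Longrightarrow> Inter_in D H S' \<subseteq> Inter_in D H S"
  by (auto simp: Inter_in_def)

locale finite_comm_group = comm_group +
  assumes finite_carrier: "finite (carrier G)"
begin

lemma finite_subgroup: "subgroup H G \<Longrightarrow> finite H"
  using finite_carrier finite_subset subgroup.subset by blast

lemma card_subgroup_pos: "subgroup H G \<Longrightarrow> 0 < card H"
  using finite_carrier subgroup.finite_imp_card_positive by blast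

lemma Inter_in_subgroup:
  assumes "subgroup D G" "\<And>j. j \<in> S \<Longrightarrow> subgroup (H j) G"
  shows "subgroup (Inter_in D H S) G"
proof -
  have "subgroup (\<Inter>(insert D (H ` S))) G" using assms by (intro subgroups_Inter) auto
  then show ?thesis by (simp add: Inter_in_def)
qed

lemma card_subgroup_dvd:
  assumes "subgroup K G" "subgroup Y G" "K \<subseteq> Y"
  shows "card K dvd card Y"
proof -
  interpret Y: group "G\<lparr>carrier := Y\<rparr>" by (rule subgroup_imp_group) fact
  have "card Y = card (rcosets\<^bsub>G\<lparr>carrier := Y\<rparr>\<^esub> K) * card K"
    using Y.lagrange[OF subgroup_incl[OF assms]] by (simp add: order_def)
  then show ?thesis by (rule dvdI[OF trans[OF _ mult.commute]])
qed

text \<open>The product set \<open>K L\<close> has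
  \<open>card K * card L / card (K \<inter> L)\<close> elements, and it is a subgroup of
  \<open>D\<close> because the group is abelian. This is the source of the submodularity of the
  rank.\<close>

lemma card_subgroups_mult_dvd:
  assumes K: "subgroup K G" and L: "subgroup L G" and D: "subgroup D G" and sub: "K \<subseteq> D" "L \<subseteq> D"
  shows "card K * card L dvd card D * card (K \<inter> L)"
proof -
  let ?f = "\<lambda>(x, y). x \<otimes> y" let ?P = "?f ` (K \<times> L)"
  have KG: "K \<subseteq> carrier G" and LG: "L \<subseteq> carrier G" using K L subgroup.subset by blast+
  have KL: "subgroup (K \<inter> L) G" by (rule subgroups_Inter_pair[OF K L])
  have "card {q \<in> K \<times> L. ?f q = ?f p} = card (K \<inter> L)" if p: "p \<in> K \<times> L" for p
  proof -
    obtain a b where ab: "p = (a, b)" "a \<in> K" "b \<in> L" using p by auto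
    have abG: "a \<in> carrier G" "b \<in> carrier G" using ab KG LG by auto
    \<comment> \<open>The factorizations of \<open>a \<otimes> b\<close> arise from
      \<open>(a, b)\<close> by moving an element \<open>g\<close> of \<open>K \<inter> L\<close>
      from one factor to the other.\<close>
    have "bij_betw (\<lambda>g. (a \<otimes> g, inv g \<otimes> b)) (K \<inter> L) {q \<in> K \<times> L. ?f q = ?f p}"
    proof (rule bij_betw_byWitness[where f' = "\<lambda>(x, y). inv a \<otimes> x"])
      show "\<forall>g\<in>K \<inter> L. (case (a \<otimes> g, inv g \<otimes> b) of (x, y) \<Rightarrow> inv a \<otimes> x) = g"
        using abG KG by (auto simp: m_assoc[symmetric])
      show "\<forall>q\<in>{q \<in> K \<times> L. ?f q = ?f p}. (\<lambda>g. (a \<otimes> g, inv g \<otimes> b)) (case q of (x, y) \<Rightarrow> inv a \<otimes> x) = q"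
      proof clarsimp
        fix x y assume xy: "x \<in> K" "y \<in> L" "x \<otimes> y = (case p of (x, y) \<Rightarrow> x \<otimes> y)"
        then have G: "x \<in> carrier G" "y \<in> carrier G" and eq: "x \<otimes> y = a \<otimes> b" using KG LG ab by auto
        have "y = inv x \<otimes> (a \<otimes> b)" using eq G abG by (metis inv_solve_left m_closed)
        then show "a \<otimes> (inv a \<otimes> x) = x \<and> inv (inv a \<otimes> x) \<otimes> b = y"
          using G abG by (simp add: m_assoc[symmetric] inv_mult_group)
      qed
      show "(\<lambda>g. (a \<otimes> g, inv g \<otimes> b)) ` (K \<inter> L) \<subseteq> {q \<in> K \<times> L. ?f q = ?f p}"
      proof clarsimp
        fix g assume g: "g \<in> K" "g \<in> L"
        then have gG: "g \<in> carrier G" using KG by auto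
        have "a \<otimes> g \<otimes> (inv g \<otimes> b) = a \<otimes> b"
          using abG gG by (simp add: m_assoc) (simp add: m_assoc[symmetric])
        then show "a \<otimes> g \<in> K \<and> inv g \<otimes> b \<in> L \<and> a \<otimes> g \<otimes> (inv g \<otimes> b) = (case p of (x, y) \<Rightarrow> x \<otimes> y)"
          using g ab K L by (auto simp: subgroup.m_closed subgroup.m_inv_closed)
      qed
      show "(\<lambda>(x, y). inv a \<otimes> x) ` {q \<in> K \<times> L. ?f q = ?f p} \<subseteq> K \<inter> L"
      proof
        fix z assume "z \<in> (\<lambda>(x, y). inv a \<otimes> x) ` {q \<in> K \<times> L. ?f q = ?f p}"
        then obtain x y where xy: "x \<in> K" "y \<in> L" "x \<otimes> y = a \<otimes> b" and z: "z = inv a \<otimes> x"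
          using ab by auto
        then have G: "x \<in> carrier G" "y \<in> carrier G" using KG LG by auto
        have "inv a \<otimes> x = b \<otimes> inv y"
          using xy(3) G abG by (metis inv_closed inv_solve_left inv_solve_right m_assoc m_closed)
        then show "z \<in> K \<inter> L"
          unfolding z using xy ab K L by (metis IntI subgroup.m_closed subgroup.m_inv_closed)
      qed
    qed
    then show ?thesis using bij_betw_same_card by fastforce
  qed
  then have "card (K \<times> L) = card (K \<inter> L) * card ?P"
    using finite_subgroup[OF K] finite_subgroup[OF L] by (intro card_fibres) auto
  then have eq: "card K * card L = card (K \<inter> L) * card ?P" by (simp add: card_cartesian_product)
  have "subgroup ?P G"
  proof (rule subgroupI)
    show "?P \<subseteq> carrier G" using KG LG by auto
    show "?P \<noteq> {}" using K L subgroup.one_closed by fastforce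
    fix p assume "p \<in> ?P"
    then obtain x y where xy: "x \<in> K" "y \<in> L" "p = x \<otimes> y" by auto
    then have "inv p = inv x \<otimes> inv y" using KG LG by (simp add: inv_mult subset_iff)
    then show "inv p \<in> ?P" using xy K L by (auto intro!: image_eqI[of _ _ "(inv x, inv y)"] subgroup.m_inv_closed)
    fix q assume "q \<in> ?P"
    then obtain x' y' where xy': "x' \<in> K" "y' \<in> L" "q = x' \<otimes> y'" by auto
    have "p \<otimes> q = (x \<otimes> x') \<otimes> (y \<otimes> y')" using xy xy' KG LG by (simp add: subset_iff m_ac)
    then show "p \<otimes> q \<in> ?P"
      using xy xy' K L by (auto intro!: image_eqI[of _ _ "(x \<otimes> x', y \<otimes> y')"] subgroup.m_closed)
  qed
  moreover have "?P \<subseteq> D" using sub D by (auto intro: subgroup.m_closed)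
  ultimately have "card ?P dvd card D" using D by (intro card_subgroup_dvd)
  then show ?thesis unfolding eq by (simp add: mult.commute mult_dvd_mono)
qed

text \<open>A homomorphism from \<open>D\<close> to the integers modulo \<open>p\<close> with kernel
  \<open>D \<inter> H\<close>. Its values are integers taken modulo \<open>p\<close>, so that they
  can serve as coefficients of linear forms.\<close>

definition char_on :: "'a set \<Rightarrow> nat \<Rightarrow> 'a set \<Rightarrow> ('a \<Rightarrow> int) \<Rightarrow> bool" where
  "char_on D p H l \<longleftrightarrow> (\<forall>d\<in>D. \<forall>e\<in>D. [l (d \<otimes> e) = l d + l e] (mod int p)) \<and>
     (\<forall>d\<in>D. int p dvd l d \<longleftrightarrow> d \<in> H)"

lemma char_on_add: "char_on D p H l \<Longrightarrow> d \<in> D \<Longrightarrow> e \<in> D \<Longrightarrow> [l (d \<otimes> e) = l d + l e] (mod int p)"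
  and char_on_kernel: "char_on D p H l \<Longrightarrow> d \<in> D \<Longrightarrow> int p dvd l d \<longleftrightarrow> d \<in> H"
  by (auto simp: char_on_def)

text \<open>The quotient of \<open>D\<close> by \<open>H\<close> has no proper nontrivial subgroup,
  hence is cyclic of prime order. The character is the exponent of a generator modulo
  \<open>H\<close>.\<close>

lemma maximal_subgroup_char:
  assumes D: "subgroup D G" and H: "subgroup H G" and HD: "H \<subset> D"
    and max: "\<And>K. subgroup K G \<Longrightarrow> H \<subset> K \<Longrightarrow> K \<subseteq> D \<Longrightarrow> K = D"
  obtains p l where "Factorial_Ring.prime p" "char_on D p H l"
proof -
  obtain g0 where g0: "g0 \<in> D" "g0 \<notin> H" using HD by blast
  have DG: "D \<subseteq> carrier G" and HG: "H \<subseteq> carrier G" using D H subgroup.subset by blast+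
  \<comment> \<open>\<open>c\<close> is the order of \<open>g0\<close> modulo \<open>H\<close>.
    Dividing it by a prime factor \<open>p\<close> yields a power \<open>g\<close> of
    \<open>g0\<close> of order \<open>p\<close> modulo \<open>H\<close>; together with
    \<open>H\<close> it generates \<open>D\<close> by maximality.\<close>
  define c where "c = (LEAST c. 0 < c \<and> g0 [^] (c::nat) \<in> H)"
  have "g0 [^] order G = \<one>" using pow_order_eq_1 g0 DG by blast
  then have "0 < order G \<and> g0 [^] order G \<in> H"
    using finite_carrier H by (simp add: order_gt_0_iff_finite subgroup.one_closed)
  then have c: "0 < c \<and> g0 [^] c \<in> H" unfolding c_def by (rule LeastI[of "\<lambda>c. 0 < c \<and> g0 [^] c \<in> H"])
  have least: "g0 [^] b \<notin> H" if "0 < b" "b < c" for b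
    using not_less_Least that unfolding c_def by blast
  have "c \<noteq> 1" using c g0 DG by (auto simp: subset_iff)
  then obtain p where p: "Factorial_Ring.prime p" "p dvd c" using prime_factor_nat by blast
  then obtain b where b: "c = p * b" by (auto elim: dvdE)
  then have "0 < b" "b < c" using c prime_gt_1_nat[OF p(1)] by auto
  define g where "g = g0 [^] b"
  have gH: "g \<notin> H" unfolding g_def by (rule least) fact+
  have gD: "g \<in> D" unfolding g_def using D g0(1) by (metis int_pow_int subgroup_int_pow_closed)
  have gG: "g \<in> carrier G" using gD DG by blast
  have gp: "g [^] int p \<in> H" using c g0 DG by (simp add: g_def b int_pow_int nat_pow_pow subset_iff mult.commute)
  have pow: "g [^] z \<in> H \<longleftrightarrow> int p dvd z" for z :: int
  proof
    assume "int p dvd z"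
    then obtain y where "z = int p * y" by (auto elim: dvdE)
    then have "g [^] z = (g [^] int p) [^] y" using gG by (simp add: int_pow_pow)
    then show "g [^] z \<in> H" using H gp subgroup_int_pow_closed by simp
  next
    assume z: "g [^] z \<in> H"
    show "int p dvd z"
    proof (rule ccontr)
      assume "\<not> int p dvd z"
      then have "coprime (int p) z" using p(1) by (simp add: prime_imp_coprime)
      then obtain u v where uv: "u * int p + v * z = 1" using bezout_int[of "int p" z] by auto
      have "g = g [^] (int p * u + z * v)" using uv gG by (simp add: mult.commute)
      also have "\<dots> = (g [^] int p) [^] u \<otimes> (g [^] z) [^] v" using gG by (simp add: int_pow_mult int_pow_pow)
      also have "\<dots> \<in> H" using H gp z by (simp add: subgroup.m_closed subgroup_int_pow_closed)
      finally show False using gH by simp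
    qed
  qed
  define K where "K = {h \<otimes> g [^] z | h z. h \<in> H \<and> z \<in> (UNIV :: int set)}"
  have "subgroup K G"
  proof (rule subgroupI)
    show "K \<subseteq> carrier G" using HG gG by (auto simp: K_def)
    show "K \<noteq> {}" using H subgroup.one_closed by (fastforce simp: K_def)
    fix a assume "a \<in> K"
    then obtain h z where a: "a = h \<otimes> g [^] (z::int)" "h \<in> H" by (auto simp: K_def)
    have "inv a = inv h \<otimes> g [^] (- z)" using a HG gG by (simp add: inv_mult subset_iff int_pow_neg)
    then show "inv a \<in> K" using a H by (auto simp: K_def subgroup.m_inv_closed)
    fix e assume "e \<in> K"
    then obtain h' z' where e: "e = h' \<otimes> g [^] (z'::int)" "h' \<in> H" by (auto simp: K_def)
    have "a \<otimes> e = (h \<otimes> h') \<otimes> g [^] (z + z')"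
      using a e HG gG by (simp add: subset_iff int_pow_mult m_ac)
    then show "a \<otimes> e \<in> K" using a e H by (auto simp: K_def subgroup.m_closed)
  qed
  moreover have "H \<subseteq> K"
  proof
    fix h assume "h \<in> H"
    then have "h = h \<otimes> g [^] (0::int)" using HG by (simp add: subset_iff)
    then show "h \<in> K" using \<open>h \<in> H\<close> unfolding K_def by blast
  qed
  moreover have "g \<in> K"
  proof -
    have "g = \<one> \<otimes> g [^] (1::int)" using gG by simp
    then show ?thesis using subgroup.one_closed[OF H] unfolding K_def by blast
  qed
  moreover have "K \<subseteq> D"
    using D HD gD by (auto simp: K_def intro!: subgroup.m_closed subgroup_int_pow_closed)
  ultimately have KD: "K = D" using gH by (intro max) auto
  define l where "l d = (SOME z. d \<otimes> inv (g [^] (z::int)) \<in> H)" for d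
  have l: "d \<otimes> inv (g [^] l d) \<in> H" if d: "d \<in> D" for d
  proof -
    obtain h z where "d = h \<otimes> g [^] (z::int)" "h \<in> H"
      using d[folded KD] unfolding K_def by blast
    then have "d \<otimes> inv (g [^] z) \<in> H" using HG gG by (simp add: subset_iff m_assoc)
    then show ?thesis unfolding l_def by (rule someI)
  qed
  have l_unique: "[l d = z] (mod int p)" if d: "d \<in> D" "d \<otimes> inv (g [^] z) \<in> H" for d z
  proof -
    have dG: "d \<in> carrier G" using d DG by blast
    have "inv (d \<otimes> inv (g [^] l d)) \<otimes> (d \<otimes> inv (g [^] z)) \<in> H"
      using l[OF d(1)] d(2) H by (simp add: subgroup.m_closed subgroup.m_inv_closed)
    also have "inv (d \<otimes> inv (g [^] l d)) \<otimes> (d \<otimes> inv (g [^] z)) = g [^] (l d - z)"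
    proof -
      have "inv (d \<otimes> inv (g [^] l d)) \<otimes> (d \<otimes> inv (g [^] z)) = g [^] l d \<otimes> inv (g [^] z)"
        using dG gG by (simp add: inv_mult m_ac) (simp add: m_assoc[symmetric])
      then show ?thesis using dG gG by (simp add: int_pow_diff)
    qed
    finally show ?thesis using pow by (simp add: cong_iff_dvd_diff)
  qed
  have "char_on D p H l"
    unfolding char_on_def
  proof (intro conjI ballI)
    fix d e assume de: "d \<in> D" "e \<in> D"
    then have G: "d \<in> carrier G" "e \<in> carrier G" using DG by auto
    have "(d \<otimes> e) \<otimes> inv (g [^] (l d + l e)) = (d \<otimes> inv (g [^] l d)) \<otimes> (e \<otimes> inv (g [^] l e))"
      using G gG by (simp add: int_pow_mult inv_mult m_ac)
    then have "(d \<otimes> e) \<otimes> inv (g [^] (l d + l e)) \<in> H"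
      using l de H by (simp add: subgroup.m_closed)
    then show "[l (d \<otimes> e) = l d + l e] (mod int p)"
      using de D by (intro l_unique) (auto simp: subgroup.m_closed)
  next
    fix d assume d: "d \<in> D"
    then have dG: "d \<in> carrier G" using DG by blast
    show "int p dvd l d \<longleftrightarrow> d \<in> H"
    proof
      assume "d \<in> H"
      then have "[l d = 0] (mod int p)" using d dG by (intro l_unique) simp_all
      then show "int p dvd l d" by (simp add: cong_0_iff)
    next
      assume "int p dvd l d"
      then have "(d \<otimes> inv (g [^] l d)) \<otimes> g [^] l d \<in> H" using l[OF d] H pow by (simp add: subgroup.m_closed)
      then show "d \<in> H" using dG gG by (simp add: m_assoc)
    qed
  qed
  with p show ?thesis using that by blast
qed

end

text \<open>From a point that serves \<open>E\<close>, move along a direction \<open>w\<close> on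
  which the new form is not constant. Every form excludes at most one of the \<open>p\<close> points
  of that line, and there are fewer than \<open>p\<close> forms.\<close>

lemma avoid_few_hyperplanes:
  assumes p: "Factorial_Ring.prime p" and "finite E" "card E < p"
    and "\<And>j. j \<in> E \<Longrightarrow> \<exists>v. \<not> int p dvd lin N (\<phi> j) v"
  shows "\<exists>x. \<forall>j\<in>E. \<not> [lin N (\<phi> j) x = a j] (mod int p)"
  using assms(2-4)
proof (induction E rule: finite_induct)
  case (insert j E)
  then obtain x where x: "\<forall>i\<in>E. \<not> [lin N (\<phi> i) x = a i] (mod int p)" by auto
  obtain w where w: "\<not> int p dvd lin N (\<phi> j) w" using insert.prems by blast
  define bad where "bad i = {z\<in>{0..<int p}. [lin N (\<phi> i) x + z * lin N (\<phi> i) w = a i] (mod int p)}" for i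
  have "card (bad i) \<le> 1" if i: "i \<in> insert j E" for i
  proof (cases "int p dvd lin N (\<phi> i) w")
    case True
    then have "i \<in> E" using i w by auto
    moreover have "[lin N (\<phi> i) x + z * lin N (\<phi> i) w = lin N (\<phi> i) x] (mod int p)" for z
      using True by (simp add: cong_iff_dvd_diff)
    ultimately have "bad i = {}" using x by (auto simp: bad_def dest: cong_trans[OF cong_sym])
    then show ?thesis by simp
  next
    case False
    have "z = z'" if "z \<in> bad i" "z' \<in> bad i" for z z'
    proof -
      have "[lin N (\<phi> i) x + z * lin N (\<phi> i) w = lin N (\<phi> i) x + z' * lin N (\<phi> i) w] (mod int p)"
        using that by (auto simp: bad_def intro: cong_trans[OF _ cong_sym])
      then have "int p dvd (z - z') * lin N (\<phi> i) w" by (simp add: cong_iff_dvd_diff algebra_simps)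
      then have "int p dvd z - z'" using False p by (simp add: prime_dvd_mult_iff)
      then have "z mod int p = z' mod int p" by (simp add: mod_eq_dvd_iff)
      then show "z = z'" using that by (simp add: bad_def)
    qed
    then show ?thesis by (metis One_nat_def card_le_Suc0_iff_eq card.infinite zero_le)
  qed
  then have "card (\<Union>i\<in>insert j E. bad i) \<le> (\<Sum>i\<in>insert j E. 1)"
    using insert.hyps by (intro order.trans[OF card_UN_le] sum_mono) auto
  also have "\<dots> < card {0..<int p}" using insert.prems by simp
  finally have "card (\<Union>i\<in>insert j E. bad i) < card {0..<int p}" .
  then have "\<not> {0..<int p} \<subseteq> (\<Union>i\<in>insert j E. bad i)"
  proof -
    have "finite (bad i)" for i by (rule finite_subset[of _ "{0..<int p}"]) (auto simp: bad_def)
    then have "finite (\<Union>i\<in>insert j E. bad i)" using insert.hyps by blast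
    then show ?thesis using card_mono \<open>card (\<Union>i\<in>insert j E. bad i) < card {0..<int p}\<close> leD by blast
  qed
  then obtain z where z: "z \<in> {0..<int p}" "\<And>i. i \<in> insert j E \<Longrightarrow> z \<notin> bad i" by blast
  have "lin N c (\<lambda>i. x i + z * w i) = lin N c x + z * lin N c w" for c
    by (simp add: lin_def distrib_left sum.distrib sum_distrib_left mult_ac)
  then show ?case using z by (intro exI[of _ "\<lambda>i. x i + z * w i"]) (auto simp: bad_def)
qed simp

lemma lin_indicator:
  assumes "finite N" "d \<in> N"
  shows "lin N c (\<lambda>i. if i = d then z else 0) = z * c d"
proof -
  have "lin N c (\<lambda>i. if i = d then z else 0) = (\<Sum>i\<in>N. if i = d then z * c d else 0)"
    unfolding lin_def by (intro sum.cong) auto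
  then show ?thesis using assms by simp
qed

context finite_comm_group
begin

section \<open>Characters, indices of their common kernels, and the case of a single prime\<close>

lemma char_on_eq_iff:
  assumes D: "subgroup D G" and l: "char_on D p H l" and d: "d \<in> D" "e \<in> D"
  shows "[l d = l e] (mod int p) \<longleftrightarrow> d \<otimes> inv e \<in> H"
proof -
  have G: "d \<in> carrier G" "e \<in> carrier G" using d D subgroup.subset by blast+
  have de: "d \<otimes> inv e \<in> D" using D d by (simp add: subgroup.m_closed subgroup.m_inv_closed)
  have "[l (d \<otimes> inv e \<otimes> e) = l (d \<otimes> inv e) + l e] (mod int p)" using l de d(2) by (rule char_on_add)
  then have eq: "[l d = l (d \<otimes> inv e) + l e] (mod int p)" using G by (simp add: m_assoc)
  have "[l d = l e] (mod int p) \<longleftrightarrow> [l (d \<otimes> inv e) + l e = l e] (mod int p)"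
    using eq cong_trans cong_sym by blast
  also have "\<dots> \<longleftrightarrow> int p dvd l (d \<otimes> inv e)" by (simp add: cong_iff_dvd_diff)
  finally show ?thesis using char_on_kernel[OF l de] by simp
qed

lemma char_on_nat_pow:
  assumes D: "subgroup D G" and l: "char_on D p H l" and H: "subgroup H G" and d: "d \<in> D"
  shows "d [^] (n::nat) \<in> D \<and> [l (d [^] n) = int n * l d] (mod int p)"
proof (induction n)
  case 0
  have "\<one> \<in> D" "\<one> \<in> H" using D H by (auto simp: subgroup.one_closed)
  then show ?case using char_on_kernel[OF l, of \<one>] by (simp add: cong_0_iff)
next
  case (Suc n)
  then have "d [^] Suc n \<in> D" using D d by (simp add: subgroup.m_closed)
  moreover have "[l (d [^] Suc n) = l (d [^] n) + l d] (mod int p)"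
    using char_on_add[OF l _ d] Suc by simp
  moreover have "[l (d [^] n) + l d = int n * l d + l d] (mod int p)"
    using Suc by (intro cong_add) auto
  ultimately show ?case using cong_trans by (auto simp: algebra_simps)
qed

lemma char_on_finprod:
  assumes D: "subgroup D G" and l: "char_on D p H l" and H: "subgroup H G"
    and A: "finite A" and f: "f \<in> A \<rightarrow> D"
  shows "finprod G f A \<in> D \<and> [l (finprod G f A) = (\<Sum>a\<in>A. l (f a))] (mod int p)"
  using A f
proof (induction A rule: finite_induct)
  case empty
  have "\<one> \<in> D" "\<one> \<in> H" using D H by (auto simp: subgroup.one_closed)
  then show ?case using char_on_kernel[OF l, of \<one>] by (simp add: cong_0_iff)
next
  case (insert a A)
  have DG: "D \<subseteq> carrier G" using D subgroup.subset by blast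
  have IH: "finprod G f A \<in> D" "[l (finprod G f A) = (\<Sum>a\<in>A. l (f a))] (mod int p)" and fa: "f a \<in> D"
    using insert by auto
  have eq: "finprod G f (insert a A) = f a \<otimes> finprod G f A"
    using insert DG by (intro finprod_insert) auto
  have "[l (f a \<otimes> finprod G f A) = l (f a) + l (finprod G f A)] (mod int p)"
    using char_on_add[OF l fa IH(1)] .
  moreover have "[l (f a) + l (finprod G f A) = l (f a) + (\<Sum>a\<in>A. l (f a))] (mod int p)"
    using IH by (intro cong_add) auto
  ultimately show ?case
    unfolding eq using insert.hyps D fa IH cong_trans by (auto simp: subgroup.m_closed)
qed

text \<open>The fibres of the joint character map are the cosets of the common kernel. Counting them
  turns a lower bound on the index of the kernel into surjectivity of the map.\<close>

lemma card_joint_fibres: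
  assumes D: "subgroup D G" and l: "\<And>j. j \<in> I \<Longrightarrow> char_on D p (H j) (l j)"
    and H: "\<And>j. j \<in> I \<Longrightarrow> subgroup (H j) G"
  shows "card D = card (Inter_in D H I) * card ((\<lambda>d. restrict (\<lambda>j. l j d mod int p) I) ` D)"
proof (rule card_fibres[OF finite_subgroup[OF D]])
  fix a assume a: "a \<in> D"
  have DG: "D \<subseteq> carrier G" using D subgroup.subset by blast
  let ?F = "{d\<in>D. restrict (\<lambda>j. l j d mod int p) I = restrict (\<lambda>j. l j a mod int p) I}"
  have mem: "d \<in> ?F \<longleftrightarrow> d \<in> D \<and> d \<otimes> inv a \<in> Inter_in D H I" for d
  proof -
    have "d \<in> ?F \<longleftrightarrow> d \<in> D \<and> (\<forall>j\<in>I. [l j d = l j a] (mod int p))"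
      by (auto simp: cong_def fun_eq_iff restrict_def)
    also have "\<dots> \<longleftrightarrow> d \<in> D \<and> (\<forall>j\<in>I. d \<otimes> inv a \<in> H j)"
      using char_on_eq_iff[OF D l] a by blast
    finally show ?thesis
      using D a by (auto simp: Inter_in_def subgroup.m_closed subgroup.m_inv_closed)
  qed
  have "bij_betw (\<lambda>d. d \<otimes> inv a) ?F (Inter_in D H I)"
  proof (rule bij_betw_byWitness[where f' = "\<lambda>d. d \<otimes> a"])
    show "\<forall>d\<in>?F. d \<otimes> inv a \<otimes> a = d" using a DG by (auto simp: m_assoc subset_iff)
    show "\<forall>d\<in>Inter_in D H I. d \<otimes> a \<otimes> inv a = d" using a DG by (auto simp: m_assoc subset_iff Inter_in_def)
    show "(\<lambda>d. d \<otimes> inv a) ` ?F \<subseteq> Inter_in D H I" using mem by blast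
    show "(\<lambda>d. d \<otimes> a) ` Inter_in D H I \<subseteq> ?F"
    proof
      fix e assume "e \<in> (\<lambda>d. d \<otimes> a) ` Inter_in D H I"
      then obtain d where d: "d \<in> Inter_in D H I" "e = d \<otimes> a" by blast
      then have "d \<in> D" by (simp add: Inter_in_def)
      then have "d \<otimes> a \<otimes> inv a = d" using a DG by (auto simp: m_assoc subset_iff)
      then show "e \<in> ?F" using d \<open>d \<in> D\<close> a D unfolding mem by (simp add: subgroup.m_closed)
    qed
  qed
  then show "card ?F = card (Inter_in D H I)" by (rule bij_betw_same_card)
qed

lemma card_char_on:
  assumes p: "Factorial_Ring.prime p" and D: "subgroup D G" and H: "subgroup H G" and HD: "H \<subset> D" and l: "char_on D p H l"
  shows "card D = p * card H"
proof -
  \<comment> \<open>A single character is treated as a family over the one-point index set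
    \<open>{()}\<close>; it remains to see that a nontrivial character modulo \<open>p\<close> is
    onto.\<close>
  let ?f = "\<lambda>d. restrict (\<lambda>_. l d mod int p) {()}"
  have "card D = card (Inter_in D (\<lambda>_. H) {()}) * card (?f ` D)"
    by (rule card_joint_fibres[OF D l H])
  moreover have "Inter_in D (\<lambda>_. H) {()} = H" using HD by (auto simp: Inter_in_def)
  moreover have "?f ` D = cube p {()}"
  proof
    show "?f ` D \<subseteq> cube p {()}" using prime_gt_0_nat[OF p] by auto
    show "cube p {()} \<subseteq> ?f ` D"
    proof
      fix y assume y: "y \<in> cube p {()}"
      obtain d where d: "d \<in> D" "d \<notin> H" using HD by blast
      then have "coprime (l d) (int p)" using char_on_kernel[OF l d(1)] p
        by (metis coprime_commute prime_imp_coprime prime_nat_int_transfer)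
      then obtain u where u: "[l d * u = 1] (mod int p)" using cong_solve_coprime_int by blast
      define n where "n = nat ((u * y ()) mod int p)"
      have n: "[int n = u * y ()] (mod int p)"
        using prime_gt_0_nat[OF p] by (simp add: n_def cong_def)
      have pow: "d [^] n \<in> D" "[l (d [^] n) = int n * l d] (mod int p)"
        using char_on_nat_pow[OF D l H d(1)] by auto
      note pow(2)
      also have "[int n * l d = (u * y ()) * l d] (mod int p)" by (intro cong_mult n cong_refl)
      also have "(u * y ()) * l d = (l d * u) * y ()" by simp
      also have "[(l d * u) * y () = 1 * y ()] (mod int p)" by (intro cong_mult u cong_refl)
      finally have "l (d [^] n) mod int p = y () mod int p" by (simp add: cong_def)
      moreover have "y () \<in> {0..<int p}" using y by auto
      ultimately have "?f (d [^] n) = y" using y by (auto simp: fun_eq_iff PiE_iff extensional_def)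
      then show "y \<in> ?f ` D" using pow(1) by blast
    qed
  qed
  ultimately show ?thesis by (simp add: card_PiE)
qed

text \<open>Intersecting with one more \<open>H j\<close> multiplies the index by a divisor of the
  prime \<open>P j\<close>; \<open>S'\<close> records where the factor is
  \<open>P j\<close>.\<close>

lemma card_Inter_in_primes:
  assumes D: "subgroup D G" and "finite S" and "\<And>j. j \<in> S \<Longrightarrow> subgroup (H j) G"
    and "\<And>j. j \<in> S \<Longrightarrow> H j \<subseteq> D" and "\<And>j. j \<in> S \<Longrightarrow> Factorial_Ring.prime (P j)"
    and "\<And>j. j \<in> S \<Longrightarrow> card D = P j * card (H j)"
  shows "\<exists>S'\<subseteq>S. card D = (\<Prod>j\<in>S'. P j) * card (Inter_in D H S)"
  using assms(2-)
proof (induction S rule: finite_induct)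
  case (insert j S)
  let ?K = "Inter_in D H S" let ?L = "Inter_in D H (insert j S)"
  obtain S' where S': "S' \<subseteq> S" "card D = (\<Prod>j\<in>S'. P j) * card ?K" using insert by auto
  have K: "subgroup ?K G" and L: "subgroup ?L G"
    using insert.prems(1) by (auto intro!: Inter_in_subgroup D)
  have "card ?K * card (H j) dvd card D * card (?K \<inter> H j)"
    using insert.prems by (intro card_subgroups_mult_dvd K D) (auto simp: Inter_in_def)
  then have "card (H j) * card ?K dvd card (H j) * (P j * card ?L)"
    using insert.prems(4)[of j] by (simp add: Inter_in_insert mult_ac)
  then have "card ?K dvd P j * card ?L"
    using card_subgroup_pos[of "H j"] insert.prems(1) by (simp add: nat_mult_dvd_cancel_disj)
  moreover have "card ?L dvd card ?K"
    by (intro card_subgroup_dvd K L) (auto simp: Inter_in_def)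
  then obtain q where q: "card ?K = card ?L * q" by (auto elim: dvdE)
  ultimately have "q dvd P j" using card_subgroup_pos[OF L] by (simp add: mult.commute)
  then have "q = 1 \<or> q = P j" using insert.prems(3)[of j] by (simp add: prime_nat_iff)
  then show ?case
  proof
    assume "q = 1"
    then show ?thesis using S' q by (intro exI[of _ S']) auto
  next
    assume "q = P j"
    moreover have "j \<notin> S'" "finite S'" using S' insert.hyps finite_subset by auto
    ultimately show ?thesis using S' q by (intro exI[of _ "insert j S'"]) (auto simp: mult_ac)
  qed
qed simp

text \<open>No basis of \<open>D\<close> is chosen: the coordinates are indexed by the elements of
  \<open>D\<close>, and a vector \<open>x\<close> stands for the product of the powers
  \<open>d [^] x d\<close>. A character then becomes the linear form with coefficients
  \<open>l j d\<close>.\<close>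

lemma avoid_cosets_prime:
  assumes D: "subgroup D G" and E: "finite E" and p: "Factorial_Ring.prime p"
    and H: "\<And>j. j \<in> E \<Longrightarrow> subgroup (H j) G" and HD: "\<And>j. j \<in> E \<Longrightarrow> H j \<subset> D"
    and l: "\<And>j. j \<in> E \<Longrightarrow> char_on D p (H j) (l j)"
    and b: "\<And>j. j \<in> E \<Longrightarrow> b j \<in> D"
    and cases: "card E < p \<or> (h + 1) ^ (t - 1) < p \<and> (h + 1) ^ (t - 1) * card E < 2 ^ h \<and>
      (\<forall>S\<subseteq>E. \<forall>r. card D = p ^ r * card (Inter_in D H S) \<longrightarrow> card S \<le> t * r)"
  shows "\<exists>d\<in>D. \<forall>j\<in>E. d \<otimes> inv (b j) \<notin> H j"
proof -
  have finD: "finite D" and neD: "D \<noteq> {}"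
    using finite_subgroup[OF D] subgroup.one_closed[OF D] by auto
  have "\<exists>x. \<forall>j\<in>E. \<not> [lin D (l j) x = l j (b j)] (mod int p)"
    using cases
  proof
    assume "card E < p"
    moreover have "\<exists>v. \<not> int p dvd lin D (l j) v" if j: "j \<in> E" for j
    proof -
      obtain d where d: "d \<in> D" "d \<notin> H j" using HD[OF j] by blast
      then have "\<not> int p dvd lin D (l j) (\<lambda>i. if i = d then 1 else 0)"
        using char_on_kernel[OF l[OF j] d(1)] lin_indicator[OF finD d(1), of "l j" 1] by simp
      then show ?thesis by blast
    qed
    ultimately show ?thesis by (intro avoid_few_hyperplanes p E)
  next
    assume *: "(h + 1) ^ (t - 1) < p \<and> (h + 1) ^ (t - 1) * card E < 2 ^ h \<and>
      (\<forall>S\<subseteq>E. \<forall>r. card D = p ^ r * card (Inter_in D H S) \<longrightarrow> card S \<le> t * r)"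
    have idx: "\<exists>r. card D = p ^ r * card (Inter_in D H S)" if S: "S \<subseteq> E" for S
    proof -
      have "\<exists>S'\<subseteq>S. card D = (\<Prod>j\<in>S'. p) * card (Inter_in D H S)"
      proof (rule card_Inter_in_primes[OF D finite_subset[OF S E]])
        fix j assume "j \<in> S"
        then have j: "j \<in> E" using S by blast
        show "subgroup (H j) G" "H j \<subseteq> D" "Factorial_Ring.prime p" using H HD p j by auto
        show "card D = p * card (H j)" by (rule card_char_on[OF p D H[OF j] HD[OF j] l[OF j]])
      qed
      then show ?thesis by auto
    qed
    \<comment> \<open>The rank of \<open>S\<close>: the index of \<open>Inter_in D H S\<close> in
      \<open>D\<close> is \<open>p ^ r S\<close>.\<close>
    define r where "r S = (SOME r. card D = p ^ r * card (Inter_in D H S))" for S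
    have r: "card D = p ^ r S * card (Inter_in D H S)" if "S \<subseteq> E" for S
      unfolding r_def by (rule someI_ex[OF idx[OF that]])
    have sg: "subgroup (Inter_in D H S) G" if "S \<subseteq> E" for S
      using that H by (intro Inter_in_subgroup D) auto
    have pos: "0 < card (Inter_in D H S)" if "S \<subseteq> E" for S
      using card_subgroup_pos[OF sg[OF that]] .
    have p1: "1 < p" by (rule prime_gt_1_nat[OF p])
    obtain c where c: "\<And>j. j \<in> E \<Longrightarrow> c j < t" "\<And>s. card {j\<in>E. c j = s} \<le> r {j\<in>E. c j = s}"
    proof (rule matroid_partition[of E r t])
      show "finite E" by (rule E)
    next
      fix A B assume AB: "A \<subseteq> B" "B \<subseteq> E"
      then have A: "A \<subseteq> E" by blast
      have "card (Inter_in D H B) \<le> card (Inter_in D H A)"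
        using AB by (intro card_mono finite_subgroup[OF sg[OF A]] Inter_in_antimono)
      then have "p ^ r A * card (Inter_in D H B) \<le> p ^ r B * card (Inter_in D H B)"
        using r[OF A] r[OF AB(2)] mult_left_mono[of "card (Inter_in D H B)" "card (Inter_in D H A)" "p ^ r A"] by simp
      then have "p ^ r A \<le> p ^ r B" using pos[OF AB(2)] by simp
      then show "r A \<le> r B" by (rule power_le_imp_le_exp[OF p1])
    next
      fix A B assume A: "A \<subseteq> E" and B: "B \<subseteq> E"
      then have U: "A \<union> B \<subseteq> E" and I: "A \<inter> B \<subseteq> E" by auto
      have "card (Inter_in D H A) * card (Inter_in D H B) dvd
        card (Inter_in D H (A \<inter> B)) * card (Inter_in D H A \<inter> Inter_in D H B)"
        using A B I by (intro card_subgroups_mult_dvd sg Inter_in_antimono) auto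
      then have le: "card (Inter_in D H A) * card (Inter_in D H B) \<le>
        card (Inter_in D H (A \<inter> B)) * card (Inter_in D H (A \<union> B))"
        using pos[OF I] pos[OF U] by (intro dvd_imp_le) (auto simp: Inter_in_Un)
      have "p ^ (r (A \<union> B) + r (A \<inter> B)) * (card (Inter_in D H A) * card (Inter_in D H B)) \<le>
        p ^ (r (A \<union> B) + r (A \<inter> B)) * (card (Inter_in D H (A \<inter> B)) * card (Inter_in D H (A \<union> B)))"
        using le by (rule mult_left_mono) simp
      also have "\<dots> = card D * card D"
        by (subst (1) r[OF U], subst r[OF I]) (simp add: power_add mult_ac)
      also have "\<dots> = p ^ (r A + r B) * (card (Inter_in D H A) * card (Inter_in D H B))"
        by (subst (1) r[OF A], subst r[OF B]) (simp add: power_add mult_ac)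
      finally have "p ^ (r (A \<union> B) + r (A \<inter> B)) \<le> p ^ (r A + r B)"
        using pos[OF A] pos[OF B] by simp
      then show "r (A \<union> B) + r (A \<inter> B) \<le> r A + r B" by (rule power_le_imp_le_exp[OF p1])
    next
      have "card D = p ^ r {} * card D" using r[of "{}"] by simp
      then have "p ^ r {} = 1" using card_subgroup_pos[OF D] by simp
      then show "r {} = 0" using p1 by simp
    next
      fix S assume "S \<subseteq> E"
      then show "card S \<le> t * r S" using * r by blast
    qed blast
    \<comment> \<open>In one class \<open>I\<close> the joint character map has
      \<open>p ^ r I \<ge> p ^ card I\<close> values, so it fills the whole cube; a preimage
      \<open>d\<close> of the target is turned into the unit vector at \<open>d\<close>.\<close>
    have indep: "\<exists>v. \<forall>j\<in>E. c j = s \<longrightarrow> [lin D (l j) v = \<tau> j] (mod int p)" if "s < t" for s \<tau>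
    proof -
      define I where "I = {j\<in>E. c j = s}"
      have IE: "I \<subseteq> E" by (auto simp: I_def)
      have finI: "finite I" using E by (simp add: I_def)
      let ?g = "\<lambda>d. restrict (\<lambda>j. l j d mod int p) I"
      have "card D = card (Inter_in D H I) * card (?g ` D)"
        using IE l H by (intro card_joint_fibres D) auto
      then have "card (Inter_in D H I) * card (?g ` D) = card (Inter_in D H I) * p ^ r I"
        using r[OF IE] by (metis mult.commute)
      then have "card (?g ` D) = p ^ r I" using pos[OF IE] by simp
      moreover have "p ^ card I \<le> p ^ r I" using c(2)[of s] p1 by (simp add: I_def power_increasing)
      moreover have "card (cube p I) = p ^ card I" using finI by (simp add: card_PiE)
      moreover have "?g ` D \<subseteq> cube p I" using p1 by auto
      moreover have "finite (cube p I)" using finI by (intro finite_PiE) auto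
      ultimately have img: "?g ` D = cube p I" by (intro card_seteq) auto
      have "restrict (\<lambda>j. \<tau> j mod int p) I \<in> ?g ` D" unfolding img using p1 by auto
      then obtain d where d: "restrict (\<lambda>j. \<tau> j mod int p) I = ?g d" "d \<in> D" by (rule imageE)
      have "[lin D (l j) (\<lambda>i. if i = d then 1 else 0) = \<tau> j] (mod int p)" if "j \<in> E" "c j = s" for j
        using fun_cong[OF d(1), of j] that lin_indicator[OF finD d(2), of "l j" 1]
        by (simp add: I_def cong_def)
      then show ?thesis by blast
    qed
    show ?thesis
    proof (rule avoid_hyperplanes[OF p finD neD E, of t c l h "\<lambda>j. l j (b j)"])
      show "\<exists>v. \<forall>j\<in>E. c j = s \<longrightarrow> [lin D (l j) v = \<tau> j] (mod int p)" if "s < t" for s \<tau>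
        by (rule indep[OF that])
      show "c j < t" if "j \<in> E" for j by (rule c(1)[OF that])
      show "(h + 1) ^ (t - 1) < p" "(h + 1) ^ (t - 1) * card E < 2 ^ h" using * by auto
    qed blast
  qed
  then obtain x where x: "\<And>j. j \<in> E \<Longrightarrow> \<not> [lin D (l j) x = l j (b j)] (mod int p)" by blast
  define f where "f d = d [^] nat (x d mod int p)" for d
  define d where "d = finprod G f D"
  \<comment> \<open>Modulo 1 every congruence is trivial, so this character yields just the closure
    of \<open>D\<close> under powers and products.\<close>
  have triv: "char_on D 1 D (\<lambda>_. 0)" by (simp add: char_on_def)
  have fD: "f \<in> D \<rightarrow> D"
    using char_on_nat_pow[OF D triv D] by (simp add: f_def)
  have dD: "d \<in> D"
    using char_on_finprod[OF D triv D finD fD] unfolding d_def by blast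
  have "d \<otimes> inv (b j) \<notin> H j" if j: "j \<in> E" for j
  proof
    assume "d \<otimes> inv (b j) \<in> H j"
    then have 1: "[l j d = l j (b j)] (mod int p)"
      using char_on_eq_iff[OF D l[OF j] dD b[OF j]] by simp
    have "[l j d = (\<Sum>e\<in>D. l j (f e))] (mod int p)"
      unfolding d_def using char_on_finprod[OF D l[OF j] H[OF j] finD fD] by blast
    also have "[(\<Sum>e\<in>D. l j (f e)) = (\<Sum>e\<in>D. l j e * x e)] (mod int p)"
    proof (rule cong_sum)
      fix e assume e: "e \<in> D"
      have "[l j (f e) = int (nat (x e mod int p)) * l j e] (mod int p)"
        unfolding f_def using char_on_nat_pow[OF D l[OF j] H[OF j] e] by blast
      also have "[int (nat (x e mod int p)) * l j e = x e * l j e] (mod int p)"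
        using prime_gt_0_nat[OF p] by (intro cong_mult) (simp_all add: cong_def)
      finally show "[l j (f e) = l j e * x e] (mod int p)" by (simp add: mult.commute)
    qed
    finally have "[l j d = lin D (l j) x] (mod int p)" by (simp add: lin_def)
    then have "[lin D (l j) x = l j (b j)] (mod int p)" using 1 cong_trans cong_sym by blast
    with x[OF j] show False by contradiction
  qed
  with dD show ?thesis by blast
qed

end

section \<open>Avoiding cosets\<close>

text \<open>For \<open>g \<ge> 2\<close> and \<open>p > 0\<close> this is the base-\<open>g\<close>
  logarithm of \<open>p\<close>, rounded up. It is also the number of independent families for the
  prime \<open>p\<close>, chosen so that the largest multiplicity
  \<open>g ^ (layers g p - 1)\<close> stays below \<open>p\<close>.\<close>

definition layers :: "nat \<Rightarrow> nat \<Rightarrow> nat" where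
  "layers g p = (LEAST t. p \<le> g ^ t)"

definition weight :: "nat \<Rightarrow> nat \<Rightarrow> nat" where
  "weight g n = (\<Sum>p\<in>#prime_factorization n. layers g p)"

lemma le_power_layers:
  assumes "2 \<le> g"
  shows "p \<le> g ^ layers g p"
proof -
  have "p \<le> g ^ p" using less_exp[of p] power_mono[OF assms, of p] by linarith
  then show ?thesis unfolding layers_def by (rule LeastI)
qed

lemma power_layers_less: "p \<noteq> 0 \<Longrightarrow> layers g p \<noteq> 0 \<Longrightarrow> g ^ (layers g p - 1) < p"
  using not_less_Least[of "layers g p - 1" "\<lambda>t. p \<le> g ^ t"] by (simp add: layers_def)

lemma layers_pos:
  assumes "2 \<le> g" "2 \<le> p"
  shows "0 < layers g p"
  using le_power_layers[OF assms(1), of p] assms(2) by (cases "layers g p") auto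

lemma weight_mult: "a \<noteq> 0 \<Longrightarrow> b \<noteq> 0 \<Longrightarrow> weight g (a * b) = weight g a + weight g b"
  by (simp add: weight_def prime_factorization_mult)

lemma weight_prime_power: "Factorial_Ring.prime p \<Longrightarrow> weight g (p ^ r) = r * layers g p"
  by (simp add: weight_def prime_factorization_prime_power)

lemma weight_pos:
  assumes "2 \<le> g" "2 \<le> n"
  shows "0 < weight g n"
proof -
  obtain p where p: "Factorial_Ring.prime p" "p dvd n" using prime_factor_nat[of n] assms(2) by auto
  then obtain m where m: "n = p * m" by (auto simp: dvd_def)
  then have "p * m \<noteq> 0" using assms(2) by linarith
  then have "m \<noteq> 0" "p \<noteq> 0" by simp_all
  then have "weight g n = 1 * layers g p + weight g m"
    using weight_prime_power[OF p(1), of g 1] by (simp add: m weight_mult)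
  then show ?thesis using layers_pos[OF assms(1), of p] prime_ge_2_nat[OF p(1)] by simp
qed

lemma weight_dvd_mono: "a dvd b \<Longrightarrow> b \<noteq> 0 \<Longrightarrow> weight g a \<le> weight g b"
  by (auto simp: dvd_def weight_mult)

lemma le_power_weight:
  assumes "2 \<le> g" "n \<noteq> 0"
  shows "n \<le> g ^ weight g n"
proof -
  have "(\<Prod>p\<in>#M. p) \<le> g ^ (\<Sum>p\<in>#M. layers g p)" for M :: "nat multiset"
    by (induction M) (auto simp: power_add intro!: mult_mono le_power_layers assms)
  from this[of "prime_factorization n"] show ?thesis
    using assms(2) by (simp add: weight_def prod_mset_prime_factorization_nat)
qed

context finite_comm_group
begin

text \<open>With \<open>K\<close> and \<open>L\<close> the two intersections, the factor
  \<open>e\<close> is the index in \<open>D\<close> of the product \<open>K L\<close>. It divides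
  the indices of both \<open>K\<close> and \<open>L\<close>, which are products over disjoint sets
  of primes, so \<open>e = 1\<close>.\<close>

lemma card_Inter_in_coprime:
  assumes D: "subgroup D G" and S: "finite S" "finite S'"
    and H: "\<And>j. j \<in> S \<union> S' \<Longrightarrow> subgroup (H j) G" "\<And>j. j \<in> S \<union> S' \<Longrightarrow> H j \<subseteq> D"
    and P: "\<And>j. j \<in> S \<union> S' \<Longrightarrow> Factorial_Ring.prime (P j)"
      "\<And>j. j \<in> S \<union> S' \<Longrightarrow> card D = P j * card (H j)"
    and ne: "\<And>i j. i \<in> S \<Longrightarrow> j \<in> S' \<Longrightarrow> P i \<noteq> P j"
  shows "card D * card (Inter_in D H (S \<union> S')) = card (Inter_in D H S) * card (Inter_in D H S')"
proof -
  let ?K = "Inter_in D H S" and ?L = "Inter_in D H S'" and ?M = "Inter_in D H (S \<union> S')"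
  have sg: "subgroup ?K G" "subgroup ?L G" "subgroup ?M G"
    using H by (auto intro!: Inter_in_subgroup D)
  note pos = card_subgroup_pos[OF sg(1)] card_subgroup_pos[OF sg(2)] card_subgroup_pos[OF sg(3)]
  have "card ?K * card ?L dvd card D * card (?K \<inter> ?L)"
    by (intro card_subgroups_mult_dvd sg D) (auto simp: Inter_in_def)
  then obtain e where e: "card D * card ?M = card ?K * card ?L * e" by (auto simp: Inter_in_Un elim: dvdE)
  obtain A where A: "A \<subseteq> S" "card D = (\<Prod>j\<in>A. P j) * card ?K"
    using card_Inter_in_primes[OF D S(1), of H P] H P by auto
  obtain B where B: "B \<subseteq> S'" "card D = (\<Prod>j\<in>B. P j) * card ?L"
    using card_Inter_in_primes[OF D S(2), of H P] H P by auto
  have "card ?M dvd card ?L" "card ?M dvd card ?K"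
    by (intro card_subgroup_dvd sg; auto simp: Inter_in_def)+
  then obtain y z where yz: "card ?L = card ?M * y" "card ?K = card ?M * z" by (auto elim!: dvdE)
  have "(card ?K * card ?M) * (\<Prod>j\<in>A. P j) = (card ?K * card ?M) * (y * e)"
    using e unfolding A(2) yz(1) by (simp only: mult_ac)
  then have eA: "e dvd (\<Prod>j\<in>A. P j)" using pos by simp
  have "(card ?L * card ?M) * (\<Prod>j\<in>B. P j) = (card ?L * card ?M) * (z * e)"
    using e unfolding B(2) yz(2) by (simp only: mult_ac)
  then have eB: "e dvd (\<Prod>j\<in>B. P j)" using pos by simp
  have "coprime (\<Prod>j\<in>A. P j) (\<Prod>j\<in>B. P j)"
  proof (intro prod_coprime_left prod_coprime_right primes_coprime)
    fix i j assume "i \<in> A" "j \<in> B"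
    then have "i \<in> S" "j \<in> S'" using A(1) B(1) by auto
    then show "P i \<noteq> P j" "Factorial_Ring.prime (P i)" "Factorial_Ring.prime (P j)" using ne P(1) by auto
  qed
  then have "e = 1" using eA eB by (meson coprime_common_divisor_nat)
  then show ?thesis using e by simp
qed

text \<open>Two reductions lead to cosets of subgroups of prime index. If the weight condition is tight
  for some proper nonempty \<open>S\<close>, then first \<open>S\<close> is avoided and afterwards the rest inside a coset
  of \<open>Inter_in D H S\<close>. If it is tight for no such \<open>S\<close>, then every \<open>H j\<close> can be enlarged until it is
  a maximal subgroup of \<open>D\<close>.\<close>
lemma avoid_cosets:
  assumes hk: "0 < h" "k * k < 2 ^ h"
    and E: "finite E" "card E \<le> k" and D: "subgroup D G"
    and H: "\<And>j. j \<in> E \<Longrightarrow> subgroup (H j) G" "\<And>j. j \<in> E \<Longrightarrow> H j \<subseteq> D"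
    and b: "\<And>j. j \<in> E \<Longrightarrow> b j \<in> D"
    and W: "\<And>S. S \<subseteq> E \<Longrightarrow> weight (h + 1) (card (Inter_in D H S)) + card S \<le> weight (h + 1) (card D)"
  shows "\<exists>d\<in>D. \<forall>j\<in>E. d \<otimes> inv (b j) \<notin> H j"
  using E D H b W
proof (induction "card E" arbitrary: E D H b rule: less_induct)
  case less
  note E = less.prems(1,2) and D = less.prems(3) and b = less.prems(6)
  have DG: "D \<subseteq> carrier G" using D subgroup.subset by blast
  let ?w = "\<lambda>Y. weight (h + 1) (card Y)"
  have g2: "2 \<le> h + 1" using hk by simp
  \<comment> \<open>Avoiding cosets of larger subgroups is harder, so each \<open>H j\<close> may be
    replaced by any \<open>H' j\<close> above it that respects the weights. The choice of greatest
    total order later forces maximality of every \<open>H' j\<close>.\<close>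
  define ok where "ok H' \<longleftrightarrow> (\<forall>j\<in>E. subgroup (H' j) G \<and> H j \<subseteq> H' j \<and> H' j \<subseteq> D) \<and>
    (\<forall>S\<subseteq>E. ?w (Inter_in D H' S) + card S \<le> ?w D)" for H'
  have "\<exists>H'. ok H' \<and> (\<forall>H''. ok H'' \<longrightarrow> (\<Sum>j\<in>E. card (H'' j)) \<le> (\<Sum>j\<in>E. card (H' j)))"
  proof (rule ex_has_greatest_nat[of ok H "\<lambda>H'. \<Sum>j\<in>E. card (H' j)" "Suc (card E * card D)"])
    show "ok H" using less.prems by (simp add: ok_def)
    show "\<forall>H'. ok H' \<longrightarrow> (\<Sum>j\<in>E. card (H' j)) < Suc (card E * card D)"
    proof (intro allI impI)
      fix H' assume "ok H'"
      then have "card (H' j) \<le> card D" if "j \<in> E" for j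
        using that finite_subgroup[OF D] by (intro card_mono) (auto simp: ok_def)
      then show "(\<Sum>j\<in>E. card (H' j)) < Suc (card E * card D)"
        using sum_bounded_above[of E "\<lambda>j. card (H' j)" "card D"] by simp
    qed
  qed
  then obtain H' where ok: "ok H'"
    and greatest: "\<And>H''. ok H'' \<Longrightarrow> (\<Sum>j\<in>E. card (H'' j)) \<le> (\<Sum>j\<in>E. card (H' j))" by blast
  have H': "\<And>j. j \<in> E \<Longrightarrow> subgroup (H' j) G" "\<And>j. j \<in> E \<Longrightarrow> H j \<subseteq> H' j" "\<And>j. j \<in> E \<Longrightarrow> H' j \<subseteq> D"
    and W: "\<And>S. S \<subseteq> E \<Longrightarrow> ?w (Inter_in D H' S) + card S \<le> ?w D"
    using ok by (auto simp: ok_def)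
  have sg: "subgroup (Inter_in D H' S) G" if "S \<subseteq> E" for S
    using that H'(1) by (intro Inter_in_subgroup D) auto
  \<comment> \<open>Having avoided \<open>S\<close> at \<open>x\<close>, search among the points
    \<open>d \<otimes> x\<close> with \<open>d\<close> in \<open>Inter_in D H' S\<close>. Such a
    \<open>d\<close> does not affect the cosets with index in \<open>S\<close>, and the remaining
    ones are handled by induction inside that smaller subgroup.\<close>
  have combine: "\<exists>d\<in>D. \<forall>j\<in>E. d \<otimes> inv (b j) \<notin> H' j"
    if S: "S \<subset> E" "S \<noteq> {}" and x: "x \<in> D" "\<forall>j\<in>S. x \<otimes> inv (b j) \<notin> H' j"
      and WS: "\<And>S'. S' \<subseteq> E - S \<Longrightarrow> ?w (Inter_in D H' (S \<union> S')) + card S' \<le> ?w (Inter_in D H' S)" for S x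
  proof -
    let ?D = "Inter_in D H' S"
    have SE: "S \<subseteq> E" using S by blast
    have DS: "subgroup ?D G" by (rule sg[OF SE])
    \<comment> \<open>A representative of the trace of the coset \<open>j\<close> on the translate
      by \<open>x\<close>. An empty trace gets the default \<open>\<one>\<close>, which merely adds
      a coset to be avoided.\<close>
    define b' where "b' j = (if \<exists>e\<in>?D. e \<otimes> x \<otimes> inv (b j) \<in> H' j
      then SOME e. e \<in> ?D \<and> e \<otimes> x \<otimes> inv (b j) \<in> H' j else \<one>)" for j
    have b': "b' j \<in> ?D \<and> (b' j \<otimes> x \<otimes> inv (b j) \<in> H' j \<or> (\<forall>e\<in>?D. e \<otimes> x \<otimes> inv (b j) \<notin> H' j))" for j
    proof (cases "\<exists>e\<in>?D. e \<otimes> x \<otimes> inv (b j) \<in> H' j")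
      case True
      then have "\<exists>e. e \<in> ?D \<and> e \<otimes> x \<otimes> inv (b j) \<in> H' j" by blast
      from someI_ex[OF this] True show ?thesis by (simp add: b'_def)
    qed (use DS subgroup.one_closed in \<open>auto simp: b'_def\<close>)
    have "\<exists>d\<in>?D. \<forall>j\<in>E - S. d \<otimes> inv (b' j) \<notin> H' j \<inter> ?D"
    proof (rule less.hyps)
      show "card (E - S) < card E" using S E by (intro psubset_card_mono) auto
      then show "card (E - S) \<le> k" using E by simp
      show "subgroup (H' j \<inter> ?D) G" if "j \<in> E - S" for j
        using that H'(1) DS by (intro subgroups_Inter_pair) auto
      fix S' assume S': "S' \<subseteq> E - S"
      have "Inter_in ?D (\<lambda>j. H' j \<inter> ?D) S' = Inter_in D H' (S \<union> S')" by (auto simp: Inter_in_def)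
      then show "?w (Inter_in ?D (\<lambda>j. H' j \<inter> ?D) S') + card S' \<le> ?w ?D" using WS[OF S'] by simp
    qed (use E DS b' in auto)
    then obtain d where d: "d \<in> ?D" "\<And>j. j \<in> E - S \<Longrightarrow> d \<otimes> inv (b' j) \<notin> H' j \<inter> ?D" by blast
    have dD: "d \<in> D" using d by (simp add: Inter_in_def)
    have G: "d \<in> carrier G" "x \<in> carrier G" using dD x DG by auto
    have "d \<otimes> x \<otimes> inv (b j) \<notin> H' j" if j: "j \<in> E" for j
    proof
      assume mem: "d \<otimes> x \<otimes> inv (b j) \<in> H' j"
      have bG: "b j \<in> carrier G" using b[OF j] DG by blast
      show False
      proof (cases "j \<in> S")
        case True
        then have "d \<in> H' j" using d by (simp add: Inter_in_def)
        then have "inv d \<otimes> (d \<otimes> x \<otimes> inv (b j)) \<in> H' j"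
          using mem H'(1)[OF j] by (simp add: subgroup.m_closed subgroup.m_inv_closed)
        moreover have "inv d \<otimes> (d \<otimes> x \<otimes> inv (b j)) = x \<otimes> inv (b j)"
          using G bG by (simp add: m_assoc[symmetric])
        ultimately show False using x(2) True by simp
      next
        case False
        then have jS: "j \<in> E - S" using j by blast
        have b'D: "b' j \<in> ?D" and b'H: "b' j \<otimes> x \<otimes> inv (b j) \<in> H' j" using b'[of j] mem d(1) by auto
        have b'G: "b' j \<in> carrier G" using b'D DG by (auto simp: Inter_in_def)
        have "d \<otimes> x \<otimes> inv (b j) \<otimes> inv (b' j \<otimes> x \<otimes> inv (b j)) \<in> H' j"
          using mem b'H H'(1)[OF j] by (simp add: subgroup.m_closed subgroup.m_inv_closed)
        also have "d \<otimes> x \<otimes> inv (b j) \<otimes> inv (b' j \<otimes> x \<otimes> inv (b j)) = d \<otimes> inv (b' j)"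
        proof -
          define y where "y = x \<otimes> inv (b j)"
          have y: "y \<in> carrier G" using G bG by (simp add: y_def)
          have "d \<otimes> x \<otimes> inv (b j) \<otimes> inv (b' j \<otimes> x \<otimes> inv (b j)) = (d \<otimes> y) \<otimes> inv (b' j \<otimes> y)"
            using G bG b'G by (simp add: y_def m_assoc)
          also have "\<dots> = d \<otimes> inv (b' j)"
            using G y b'G by (simp add: inv_mult m_ac) (simp add: m_assoc[symmetric])
          finally show ?thesis .
        qed
        finally have "d \<otimes> inv (b' j) \<in> H' j \<inter> ?D"
          using d(1) b'D DS by (auto simp: subgroup.m_closed subgroup.m_inv_closed)
        with d(2)[OF jS] show False by contradiction
      qed
    qed
    moreover have "d \<otimes> x \<in> D" using dD x D by (simp add: subgroup.m_closed)
    ultimately show ?thesis by blast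
  qed
  have "\<exists>d\<in>D. \<forall>j\<in>E. d \<otimes> inv (b j) \<notin> H' j"
  proof (cases "\<exists>S\<subset>E. S \<noteq> {} \<and> ?w (Inter_in D H' S) + card S = ?w D")
    case True
    then obtain S where S: "S \<subset> E" "S \<noteq> {}" "?w (Inter_in D H' S) + card S = ?w D" by blast
    have "\<exists>x\<in>D. \<forall>j\<in>S. x \<otimes> inv (b j) \<notin> H' j"
    proof (rule less.hyps)
      show c: "card S < card E" using S E by (intro psubset_card_mono) auto
      then show "card S \<le> k" using E by simp
      show "finite S" using S E finite_subset by blast
      show "subgroup D G" by (rule D)
      show "?w (Inter_in D H' S') + card S' \<le> ?w D" if "S' \<subseteq> S" for S'
        using that S(1) by (intro W) blast
      show "subgroup (H' j) G" "H' j \<subseteq> D" "b j \<in> D" if "j \<in> S" for j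
        using that S(1) H'(1,3)[of j] b[of j] by blast+
    qed
    then obtain x where x: "x \<in> D" "\<forall>j\<in>S. x \<otimes> inv (b j) \<notin> H' j" by blast
    show ?thesis
    proof (rule combine[OF S(1,2) x])
      fix S' assume S': "S' \<subseteq> E - S"
      then have "card (S \<union> S') = card S + card S'"
        using S E finite_subset by (intro card_Un_disjoint) auto
      moreover have "?w (Inter_in D H' (S \<union> S')) + card (S \<union> S') \<le> ?w D" using S S' by (intro W) auto
      ultimately show "?w (Inter_in D H' (S \<union> S')) + card S' \<le> ?w (Inter_in D H' S)" using S(3) by linarith
    qed
  next
    case False
    have strict: "?w (Inter_in D H' S) + card S < ?w D" if "S \<subset> E" "S \<noteq> {}" for S
      using False W[of S] that by (metis le_neq_implies_less psubset_imp_subset)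
    have HD: "H' j \<subset> D" if j: "j \<in> E" for j
    proof -
      have "Inter_in D H' {j} = H' j" using H'(3)[OF j] by (auto simp: Inter_in_def)
      then have "?w (H' j) + 1 \<le> ?w D" using W[of "{j}"] j by simp
      then show ?thesis using H'(3)[OF j] by auto
    qed
    have "\<exists>p l. Factorial_Ring.prime p \<and> char_on D p (H' j) l" if j: "j \<in> E" for j
    proof -
      have "K = D" if K: "subgroup K G" "H' j \<subset> K" "K \<subseteq> D" for K
      proof (rule ccontr)
        assume KD: "K \<noteq> D"
        let ?H = "H'(j := K)"
        \<comment> \<open>Enlarging \<open>H' j\<close> keeps the condition: for
          \<open>j \<in> S\<close>, drop \<open>j\<close> and use that the inequality for
          \<open>S - {j}\<close> is strict. If \<open>S = {j}\<close>, use that a proper subgroup of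
          \<open>D\<close> has smaller weight.\<close>
        have "?w (Inter_in D ?H S) + card S \<le> ?w D" if S: "S \<subseteq> E" for S
        proof (cases "j \<in> S")
          case False
          then have "Inter_in D ?H S = Inter_in D H' S" by (auto simp: Inter_in_def)
          then show ?thesis using W[OF S] by simp
        next
          case True
          let ?S0 = "S - {j}"
          have cS: "card S = card ?S0 + 1"
            using True finite_subset[OF S E(1)] by (metis Suc_eq_plus1 card_Suc_Diff1)
          show ?thesis
          proof (cases "?S0 = {}")
            case True
            then have "S = {j}" using \<open>j \<in> S\<close> by blast
            then have Inter_K: "Inter_in D ?H S = K" "card S = 1" using K by (auto simp: Inter_in_def)
            obtain q where q: "card D = card K * q"
              using card_subgroup_dvd[OF K(1) D K(3)] by (auto elim: dvdE)
            have "q \<noteq> 0" "card K \<noteq> 0" using q card_subgroup_pos[OF D] by auto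
            moreover have "q \<noteq> 1" using q KD K card_subset_eq[OF finite_subgroup[OF D] K(3)] by auto
            ultimately have "?w D = ?w K + weight (h + 1) q" "0 < weight (h + 1) q"
              using q weight_pos[OF g2, of q] by (auto simp: weight_mult)
            then show ?thesis using Inter_K by simp
          next
            case False
            have S0: "?S0 \<subset> E" using S j by blast
            have "Inter_in D ?H S \<subseteq> Inter_in D H' ?S0" by (auto simp: Inter_in_def)
            moreover have "subgroup (Inter_in D ?H S) G"
              using S H'(1) K(1) by (intro Inter_in_subgroup D) auto
            moreover have "subgroup (Inter_in D H' ?S0) G" using S by (intro sg) auto
            ultimately have "?w (Inter_in D ?H S) \<le> ?w (Inter_in D H' ?S0)"
              using card_subgroup_pos by (intro weight_dvd_mono card_subgroup_dvd) auto
            then show ?thesis using strict[OF S0 False] cS by linarith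
          qed
        qed
        moreover have "H j \<subseteq> K" using H'(2)[OF j] K(2) by blast
        ultimately have "ok ?H" unfolding ok_def using H' K by simp
        moreover have "(\<Sum>i\<in>E. card (H' i)) < (\<Sum>i\<in>E. card (?H i))"
        proof (rule sum_strict_mono_ex1[OF E(1)])
          show "\<forall>i\<in>E. card (H' i) \<le> card (?H i)"
            using K(2) finite_subgroup[OF K(1)] by (auto intro: card_mono)
          show "\<exists>i\<in>E. card (H' i) < card (?H i)"
            using j psubset_card_mono[OF finite_subgroup[OF K(1)] K(2)] by auto
        qed
        ultimately show False using greatest[of ?H] by simp
      qed
      then show ?thesis using maximal_subgroup_char[OF D H'(1)[OF j] HD[OF j]] by metis
    qed
    then obtain P l where P: "\<And>j. j \<in> E \<Longrightarrow> Factorial_Ring.prime (P j)"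
      and l: "\<And>j. j \<in> E \<Longrightarrow> char_on D (P j) (H' j) (l j)" by metis
    have idx: "card D = P j * card (H' j)" if "j \<in> E" for j
      using that by (intro card_char_on[of _ _ _ "l j"] P D H' HD l)
    show ?thesis
    proof (cases "E = {}")
      case True
      then show ?thesis using D subgroup.one_closed by blast
    next
      case False
      then obtain j0 where j0: "j0 \<in> E" by blast
      define p where "p = P j0"
      \<comment> \<open>The indices belonging to one prime are treated first; those of other primes
        impose independent conditions and are left to \<open>combine\<close>.\<close>
      define Ep where "Ep = {j\<in>E. P j = p}"
      have p: "Factorial_Ring.prime p" unfolding p_def by (rule P[OF j0])
      have Ep: "Ep \<subseteq> E" "j0 \<in> Ep" "finite Ep" using j0 E by (auto simp: Ep_def p_def)
      let ?t = "layers (h + 1) p"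
      have "card Ep < p \<or> (h + 1) ^ (?t - 1) < p \<and> (h + 1) ^ (?t - 1) * card Ep < 2 ^ h \<and>
        (\<forall>S\<subseteq>Ep. \<forall>r. card D = p ^ r * card (Inter_in D H' S) \<longrightarrow> card S \<le> ?t * r)"
      proof (cases "card Ep < p")
        case False
        have cE: "card Ep \<le> k" using card_mono[OF E(1) Ep(1)] E(2) by simp
        have t: "(h + 1) ^ (?t - 1) < p"
          using layers_pos[OF g2 prime_ge_2_nat[OF p]] prime_gt_0_nat[OF p] by (intro power_layers_less) auto
        \<comment> \<open>In this case \<open>p \<le> card Ep \<le> k\<close>, so the largest
          multiplicity is itself below \<open>k\<close>. This is where \<open>k * k < 2 ^ h\<close>
          comes from.\<close>
        moreover have "(h + 1) ^ (?t - 1) * card Ep \<le> k * k" using t cE False by (intro mult_mono) auto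
        then have "(h + 1) ^ (?t - 1) * card Ep < 2 ^ h" using hk(2) by simp
        moreover have "card S \<le> ?t * r" if S: "S \<subseteq> Ep" "card D = p ^ r * card (Inter_in D H' S)" for S r
        proof -
          have SE: "S \<subseteq> E" using S Ep by blast
          have "?w D = r * ?t + ?w (Inter_in D H' S)"
            using card_subgroup_pos[OF sg[OF SE]] prime_gt_0_nat[OF p]
            by (simp add: S(2) weight_mult weight_prime_power[OF p])
          then show ?thesis using W[OF SE] by (simp add: mult.commute)
        qed
        ultimately show ?thesis by blast
      qed simp
      then have "\<exists>x\<in>D. \<forall>j\<in>Ep. x \<otimes> inv (b j) \<notin> H' j"
      proof (rule avoid_cosets_prime[OF D Ep(3) p, rotated -1])
        fix j assume "j \<in> Ep"
        then have j: "j \<in> E" "P j = p" by (auto simp: Ep_def)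
        show "subgroup (H' j) G" "H' j \<subset> D" "b j \<in> D" using H'(1) HD b j by auto
        show "char_on D p (H' j) (l j)" using l[OF j(1)] j(2) by simp
      qed
      then obtain x where x: "x \<in> D" "\<forall>j\<in>Ep. x \<otimes> inv (b j) \<notin> H' j" by blast
      show ?thesis
      proof (cases "Ep = E")
        case True
        then show ?thesis using x by blast
      next
        case False
        show ?thesis
        proof (rule combine[OF _ _ x])
          show "Ep \<subset> E" "Ep \<noteq> {}" using False Ep by auto
          fix S' assume S': "S' \<subseteq> E - Ep"
          have S'E: "S' \<subseteq> E" using S' by blast
          \<comment> \<open>Indices for different primes multiply, so their weights add; the weight
            condition for \<open>S'\<close> in \<open>D\<close> therefore passes to the subgroup
            \<open>Inter_in D H' Ep\<close>.\<close>
          have "card D * card (Inter_in D H' (Ep \<union> S')) = card (Inter_in D H' Ep) * card (Inter_in D H' S')"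
          proof (rule card_Inter_in_coprime[where P = P, OF D Ep(3) finite_subset[OF S'E E(1)]])
            fix j assume "j \<in> Ep \<union> S'"
            then have j: "j \<in> E" using Ep S'E by blast
            show "subgroup (H' j) G" "H' j \<subseteq> D" "Factorial_Ring.prime (P j)" "card D = P j * card (H' j)"
              by (fact H'(1)[OF j] H'(3)[OF j] P[OF j] idx[OF j])+
          qed (use S' in \<open>auto simp: Ep_def\<close>)
          then have "weight (h + 1) (card D * card (Inter_in D H' (Ep \<union> S'))) =
              weight (h + 1) (card (Inter_in D H' Ep) * card (Inter_in D H' S'))" by simp
          moreover have "0 < card (Inter_in D H' (Ep \<union> S'))" "0 < card (Inter_in D H' Ep)"
            "0 < card (Inter_in D H' S')" "0 < card D"
            using Ep S'E by (auto intro!: card_subgroup_pos sg D)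
          ultimately have "?w D + ?w (Inter_in D H' (Ep \<union> S')) = ?w (Inter_in D H' Ep) + ?w (Inter_in D H' S')"
            by (simp add: weight_mult)
          then show "?w (Inter_in D H' (Ep \<union> S')) + card S' \<le> ?w (Inter_in D H' Ep)" using W[OF S'E] by simp
        qed
      qed
    qed
  qed
  then show ?case using H'(2) by blast
qed

end

section \<open>Reduction to finite groups\<close>

lemma (in group) coset_mem_iff:
  assumes "subgroup H G" "x \<in> carrier G" "a \<in> carrier G"
  shows "a \<in> H #> x \<longleftrightarrow> a \<otimes> inv x \<in> H"
  using assms by (intro subgroup.rcos_module group_axioms) auto

lemma (in group) Union_cosets_eq_carrier_iff:
  assumes "\<And>i. i \<in> J \<Longrightarrow> subgroup (H i) G" "\<And>i. i \<in> J \<Longrightarrow> x i \<in> carrier G"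
  shows "(\<Union>i\<in>J. H i #> x i) = carrier G \<longleftrightarrow> (\<forall>a\<in>carrier G. \<exists>i\<in>J. a \<otimes> inv (x i) \<in> H i)"
proof -
  have "(\<Union>i\<in>J. H i #> x i) \<subseteq> carrier G"
    using assms by (intro UN_least r_coset_subset_G) (auto simp: subgroup.subset)
  then have "(\<Union>i\<in>J. H i #> x i) = carrier G \<longleftrightarrow> (\<forall>a\<in>carrier G. \<exists>i\<in>J. a \<in> H i #> x i)"
    by blast
  then show ?thesis using assms coset_mem_iff by (metis (no_types, lifting))
qed

text \<open>B. H. Neumann's argument: if \<open>K\<close> has infinite index, some coset
  \<open>K #> g\<close> is not among the listed ones and is therefore covered by cosets of the other
  subgroups. Translates of this cover replace all listed cosets of \<open>K\<close>, and the family
  shrinks.\<close>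

lemma (in group) Neumann_finite_index:
  assumes "finite \<H>" "\<And>K. K \<in> \<H> \<Longrightarrow> subgroup K G" "finite Y" "Y \<subseteq> carrier G"
    and "carrier G \<subseteq> (\<Union>K\<in>\<H>. \<Union>y\<in>Y. K #> y)"
  shows "\<exists>K\<in>\<H>. finite (rcosets K)"
  using assms
proof (induction \<H> arbitrary: Y rule: finite_induct)
  case empty
  then show ?case using one_closed by blast
next
  case (insert K \<H>)
  note K = insert.prems(1)[of K, simplified] and Y = insert.prems(2,3) and cover = insert.prems(4)
  show ?case
  proof (cases "finite (rcosets K)")
    case False
    then obtain g where g: "g \<in> carrier G" "K #> g \<notin> (\<lambda>y. K #> y) ` Y"
      using finite_subset[of "rcosets K" "(\<lambda>y. K #> y) ` Y"] Y(1) by (auto simp: RCOSETS_def)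
    define Z where "Z = Y \<union> (\<lambda>(y, y'). y \<otimes> inv g \<otimes> y') ` (Y \<times> Y)"
    have "carrier G \<subseteq> (\<Union>L\<in>\<H>. \<Union>z\<in>Z. L #> z)"
    proof
      fix a assume a: "a \<in> carrier G"
      then obtain L y where L: "L \<in> insert K \<H>" "y \<in> Y" "a \<in> L #> y" using cover by blast
      show "a \<in> (\<Union>L\<in>\<H>. \<Union>z\<in>Z. L #> z)"
      proof (cases "L \<in> \<H>")
        case True
        then show ?thesis using L by (auto simp: Z_def)
      next
        case False
        then have LK: "L = K" using L by blast
        have yG: "y \<in> carrier G" using L Y by blast
        define c where "c = a \<otimes> inv y"
        have c: "c \<in> K" using L(3) coset_mem_iff[OF K yG a] by (simp add: LK c_def)
        then have cG: "c \<in> carrier G" using K subgroup.subset by blast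
        have cg: "c \<otimes> g \<in> K #> g" using c by (auto simp: r_coset_def)
        obtain L' y' where L': "L' \<in> insert K \<H>" "y' \<in> Y" "c \<otimes> g \<in> L' #> y'"
          using cover cG g(1) by blast
        have y'G: "y' \<in> carrier G" using L' Y by blast
        have "L' \<noteq> K"
        proof
          assume "L' = K"
          then have "K #> g = K #> y'"
            using repr_independence[OF cg g(1) K] repr_independence[OF _ y'G K, of "c \<otimes> g"] L'(3) by simp
          then show False using g(2) L'(2) by blast
        qed
        then have L'H: "L' \<in> \<H>" using L' by blast
        have sL': "subgroup L' G" using L'H insert.prems(1) by blast
        have "(c \<otimes> g) \<otimes> inv y' \<in> L'" using L'(3) coset_mem_iff[OF sL' y'G] cG g(1) by simp
        moreover have "(c \<otimes> g) \<otimes> inv y' = a \<otimes> inv (y' \<otimes> inv g \<otimes> y)"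
          using a yG y'G g(1) by (simp add: c_def inv_mult_group m_assoc)
        ultimately have "a \<in> L' #> (y' \<otimes> inv g \<otimes> y)"
          using coset_mem_iff[OF sL' _ a] y'G yG g(1) by simp
        moreover have "y' \<otimes> inv g \<otimes> y \<in> Z" using L'(2) L(2) by (auto simp: Z_def)
        ultimately show ?thesis using L'H by blast
      qed
    qed
    moreover have "finite Z" "Z \<subseteq> carrier G" using Y g(1) by (auto simp: Z_def)
    ultimately have "\<exists>K\<in>\<H>. finite (rcosets K)" using insert.prems(1) by (intro insert.IH) auto
    then show ?thesis by blast
  qed blast
qed

lemma (in group) finite_rcosets_Int:
  assumes "subgroup K G" "subgroup L G" "finite (rcosets K)" "finite (rcosets L)"
  shows "finite (rcosets (K \<inter> L))"
proof (rule finite_subset)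
  have "(K \<inter> L) #> a = (K #> a) \<inter> (L #> a)" if a: "a \<in> carrier G" for a
  proof -
    have "b \<in> (K \<inter> L) #> a \<longleftrightarrow> b \<in> (K #> a) \<inter> (L #> a)" if "b \<in> carrier G" for b
      using coset_mem_iff a that assms subgroups_Inter_pair by auto
    moreover have "K \<subseteq> carrier G" using assms(1) by (rule subgroup.subset)
    then have "(K \<inter> L) #> a \<subseteq> carrier G" "K #> a \<subseteq> carrier G"
      using a by (simp_all add: r_coset_subset_G le_infI1)
    ultimately show ?thesis by blast
  qed
  then show "rcosets (K \<inter> L) \<subseteq> (\<lambda>(R, S). R \<inter> S) ` ((rcosets K) \<times> (rcosets L))"
    by (auto simp: RCOSETS_def)
qed (use assms in auto)

lemma (in group) finite_rcosets_Inter_in: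
  assumes "finite S" "\<And>i. i \<in> S \<Longrightarrow> subgroup (H i) G" "\<And>i. i \<in> S \<Longrightarrow> finite (rcosets (H i))"
  shows "subgroup (Inter_in (carrier G) H S) G \<and> finite (rcosets (Inter_in (carrier G) H S))"
  using assms
proof (induction S rule: finite_induct)
  case empty
  have "rcosets (carrier G) \<subseteq> {carrier G}"
    by (auto simp: RCOSETS_def subgroup_self coset_join2)
  then show ?case using finite_subset by (auto simp: subgroup_self)
next
  case (insert i S)
  then show ?case by (auto simp: Inter_in_insert intro!: finite_rcosets_Int subgroups_Inter_pair)
qed

text \<open>If some \<open>H i\<close> had infinite index, the finite-index cosets would miss a
  point \<open>z\<close>, hence the whole coset \<open>D #> z\<close>. The infinite-index cosets
  cover it, and finitely many translates cover the group, against Neumann's lemma.\<close>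

lemma (in group) irredundant_cover_finite_index:
  assumes cov: "irredundant_coset_cover G k H x"
  shows "finite (rcosets (Inter_in (carrier G) H {1..k}))"
proof -
  have H: "\<And>i. i \<in> {1..k} \<Longrightarrow> subgroup (H i) G" and x: "\<And>i. i \<in> {1..k} \<Longrightarrow> x i \<in> carrier G"
    and irr: "\<And>J. J \<subset> {1..k} \<Longrightarrow> (\<Union>i\<in>J. H i #> x i) \<noteq> carrier G"
    and un: "(\<Union>i\<in>{1..k}. H i #> x i) = carrier G"
    using cov by (auto simp: irredundant_coset_cover_def)
  define I where "I = {i\<in>{1..k}. finite (rcosets (H i))}"
  define D where "D = Inter_in (carrier G) H I"
  have D: "subgroup D G" "finite (rcosets D)"
  proof -
    have "subgroup D G \<and> finite (rcosets D)"
      unfolding D_def by (rule finite_rcosets_Inter_in) (simp_all add: I_def H)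
    then show "subgroup D G" "finite (rcosets D)" by auto
  qed
  have "I = {1..k}"
  proof (rule ccontr)
    assume "I \<noteq> {1..k}"
    then have "I \<subset> {1..k}" by (auto simp: I_def)
    then have "(\<Union>i\<in>I. H i #> x i) \<noteq> carrier G" by (rule irr)
    moreover have "(\<Union>i\<in>I. H i #> x i) = carrier G \<longleftrightarrow> (\<forall>a\<in>carrier G. \<exists>i\<in>I. a \<otimes> inv (x i) \<in> H i)"
      by (rule Union_cosets_eq_carrier_iff) (simp_all add: I_def H x)
    ultimately obtain z where z: "z \<in> carrier G" "\<And>i. i \<in> I \<Longrightarrow> z \<otimes> inv (x i) \<notin> H i"
      by blast
    have "rcosets D \<subseteq> (\<lambda>g. D #> g) ` carrier G" by (auto simp: RCOSETS_def)
    from finite_subset_image[OF D(2) this]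
    obtain R where R: "R \<subseteq> carrier G" "finite R" "rcosets D = (\<lambda>g. D #> g) ` R" by blast
    define Y where "Y = (\<lambda>(i, g). x i \<otimes> inv z \<otimes> g) ` (({1..k} - I) \<times> R)"
    have "\<exists>K\<in>H ` ({1..k} - I). finite (rcosets K)"
    proof (rule Neumann_finite_index)
      show "finite Y" using R by (simp add: Y_def)
      show "Y \<subseteq> carrier G" using R x z by (auto simp: Y_def)
      show "carrier G \<subseteq> (\<Union>K\<in>H ` ({1..k} - I). \<Union>y\<in>Y. K #> y)"
      proof
        fix a assume a: "a \<in> carrier G"
        then have "D #> a \<in> rcosets D" using D(1) subgroup.subset by (auto intro!: rcosetsI)
        then obtain g where g: "g \<in> R" "D #> a = D #> g" unfolding R(3) by blast
        have gG: "g \<in> carrier G" using g R by blast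
        have "a \<in> D #> g" using rcos_self[OF a D(1)] g(2) by simp
        then have ag: "a \<otimes> inv g \<in> D" using coset_mem_iff[OF D(1) gG a] by simp
        define c where "c = a \<otimes> inv g \<otimes> z"
        have cG: "c \<in> carrier G" using a gG z by (simp add: c_def)
        then obtain i where i: "i \<in> {1..k}" "c \<otimes> inv (x i) \<in> H i"
          using un Union_cosets_eq_carrier_iff[of "{1..k}" H x] H x by blast
        have "i \<notin> I"
        proof
          assume iI: "i \<in> I"
          then have "a \<otimes> inv g \<in> H i" using ag by (simp add: D_def Inter_in_def)
          then have "inv (a \<otimes> inv g) \<otimes> (c \<otimes> inv (x i)) \<in> H i"
            using i H by (meson subgroup.m_closed subgroup.m_inv_closed)
          moreover have "inv (a \<otimes> inv g) \<otimes> (c \<otimes> inv (x i)) = z \<otimes> inv (x i)"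
          proof -
            define u where "u = a \<otimes> inv g"
            have "u \<in> carrier G" using a gG by (simp add: u_def)
            then have "inv u \<otimes> (u \<otimes> z \<otimes> inv (x i)) = z \<otimes> inv (x i)"
              using z x[OF i(1)] by (simp add: m_assoc[symmetric])
            then show ?thesis by (simp add: u_def c_def)
          qed
          ultimately show False using z(2)[OF iI] by simp
        qed
        have "c \<otimes> inv (x i) = a \<otimes> inv (x i \<otimes> inv z \<otimes> g)"
          using a gG z x[OF i(1)] by (simp add: c_def inv_mult_group m_assoc)
        then have "a \<in> H i #> (x i \<otimes> inv z \<otimes> g)"
          using i coset_mem_iff[OF H[OF i(1)] _ a] gG z x by simp
        moreover have "x i \<otimes> inv z \<otimes> g \<in> Y" using i(1) \<open>i \<notin> I\<close> g(1) by (auto simp: Y_def)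
        ultimately show "a \<in> (\<Union>K\<in>H ` ({1..k} - I). \<Union>y\<in>Y. K #> y)"
          using i(1) \<open>i \<notin> I\<close> by blast
      qed
    qed (use H in auto)
    then show False by (auto simp: I_def)
  qed
  then show ?thesis using D(2) by (simp add: D_def)
qed

text \<open>Factor out the intersection \<open>N\<close> and number its finitely many cosets. Since
  \<open>N\<close> lies in every \<open>H i\<close>, a subfamily covers the quotient exactly when it
  covers the group. This provides finiteness and also the fixed element type over which the constant
  is defined.\<close>

lemma cover_on_nat:
  assumes A: "comm_group A" and cov: "irredundant_coset_cover A k H x"
  shows "\<exists>(B :: nat monoid) H' x'. comm_group B \<and> finite (carrier B) \<and> irredundant_coset_cover B k H' x' \<and>
    card (rcosets\<^bsub>B\<^esub> (Inter_in (carrier B) H' {1..k})) = card (rcosets\<^bsub>A\<^esub> (Inter_in (carrier A) H {1..k}))"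
proof -
  interpret A: comm_group A by fact
  have H: "\<And>i. i \<in> {1..k} \<Longrightarrow> subgroup (H i) A" and x: "\<And>i. i \<in> {1..k} \<Longrightarrow> x i \<in> carrier A"
    and irr: "\<And>J. J \<subset> {1..k} \<Longrightarrow> (\<Union>i\<in>J. H i #>\<^bsub>A\<^esub> x i) \<noteq> carrier A"
    and un: "(\<Union>i\<in>{1..k}. H i #>\<^bsub>A\<^esub> x i) = carrier A"
    using cov by (auto simp: irredundant_coset_cover_def)
  define N where "N = Inter_in (carrier A) H {1..k}"
  have fin: "finite (rcosets\<^bsub>A\<^esub> N)" unfolding N_def by (rule A.irredundant_cover_finite_index[OF cov])
  have NH: "N \<subseteq> H i" if "i \<in> {1..k}" for i using that by (auto simp: N_def Inter_in_def)
  have N: "subgroup N A"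
  proof -
    have "subgroup (\<Inter>(insert (carrier A) (H ` {1..k}))) A"
      using H by (intro A.subgroups_Inter) (auto intro: A.subgroup_self)
    then show ?thesis by (simp add: N_def Inter_in_def)
  qed
  obtain g :: "'a set \<Rightarrow> nat" where g: "inj_on g (rcosets\<^bsub>A\<^esub> N)"
    using finite_imp_inj_to_nat_seg[OF fin] by auto
  define f where "f a = g (N #>\<^bsub>A\<^esub> a)" for a
  have rc: "N #>\<^bsub>A\<^esub> a \<in> rcosets\<^bsub>A\<^esub> N" if "a \<in> carrier A" for a
    using that N subgroup.subset by (intro A.rcosetsI) auto
  have f_eq: "f a = f b \<longleftrightarrow> a \<otimes>\<^bsub>A\<^esub> inv\<^bsub>A\<^esub> b \<in> N" if ab: "a \<in> carrier A" "b \<in> carrier A" for a b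
  proof -
    have "f a = f b \<longleftrightarrow> N #>\<^bsub>A\<^esub> a = N #>\<^bsub>A\<^esub> b"
      using inj_on_eq_iff[OF g rc[OF ab(1)] rc[OF ab(2)]] by (simp add: f_def)
    also have "\<dots> \<longleftrightarrow> a \<in> N #>\<^bsub>A\<^esub> b"
      using A.rcos_self[OF ab(1) N] A.repr_independence[OF _ ab(2) N] by auto
    also have "\<dots> \<longleftrightarrow> a \<otimes>\<^bsub>A\<^esub> inv\<^bsub>A\<^esub> b \<in> N" by (rule A.coset_mem_iff[OF N ab(2,1)])
    finally show ?thesis .
  qed
  have weak: "weak_group_morphism f N A"
    using f_eq A.subgroup_imp_normal[OF N] by (intro weak_group_morphismsI) auto
  define B where "B = image_group f A"
  interpret f: group_hom A B f unfolding B_def by (rule A.weak_group_morphism_group_hom[OF weak])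
  have carB: "carrier B = f ` carrier A" by (simp add: B_def image_group_carrier)
  have "comm_group B"
  proof (rule f.H.group_comm_groupI)
    fix a b assume "a \<in> carrier B" "b \<in> carrier B"
    then obtain a' b' where "a' \<in> carrier A" "b' \<in> carrier A" "a = f a'" "b = f b'" by (auto simp: carB)
    then show "a \<otimes>\<^bsub>B\<^esub> b = b \<otimes>\<^bsub>B\<^esub> a" by (simp flip: f.hom_mult add: A.m_comm)
  qed
  moreover have fB: "carrier B = g ` (rcosets\<^bsub>A\<^esub> N)"
    by (auto simp: carB f_def RCOSETS_def)
  then have "finite (carrier B)" using fin by simp
  moreover have mem: "f a \<in> f ` H i \<longleftrightarrow> a \<in> H i" if a: "a \<in> carrier A" and i: "i \<in> {1..k}" for a i
  proof
    assume "f a \<in> f ` H i"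
    then obtain h where h: "h \<in> H i" "f a = f h" by auto
    then have hA: "h \<in> carrier A" using H[OF i] subgroup.mem_carrier by metis
    have "a \<otimes>\<^bsub>A\<^esub> inv\<^bsub>A\<^esub> h \<in> H i" using f_eq[OF a hA] h(2) NH[OF i] by auto
    then have "a \<otimes>\<^bsub>A\<^esub> inv\<^bsub>A\<^esub> h \<otimes>\<^bsub>A\<^esub> h \<in> H i" using h(1) H[OF i] by (simp add: subgroup.m_closed)
    then show "a \<in> H i" using a hA by (simp add: A.m_assoc)
  qed simp
  have sB: "subgroup (f ` H i) B" if "i \<in> {1..k}" for i
    using H[OF that] by (rule f.subgroup_img_is_subgroup)
  have cov_iff: "(\<Union>i\<in>J. f ` H i #>\<^bsub>B\<^esub> f (x i)) = carrier B \<longleftrightarrow> (\<Union>i\<in>J. H i #>\<^bsub>A\<^esub> x i) = carrier A"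
    if J: "J \<subseteq> {1..k}" for J
  proof -
    have HJ: "subgroup (H i) A" "x i \<in> carrier A" "subgroup (f ` H i) B" "f (x i) \<in> carrier B" if "i \<in> J" for i
      using that J H[of i] x[of i] sB[of i] by auto
    have "(\<Union>i\<in>J. f ` H i #>\<^bsub>B\<^esub> f (x i)) = carrier B \<longleftrightarrow>
      (\<forall>a\<in>carrier A. \<exists>i\<in>J. f a \<otimes>\<^bsub>B\<^esub> inv\<^bsub>B\<^esub> f (x i) \<in> f ` H i)"
      using f.H.Union_cosets_eq_carrier_iff[of J "\<lambda>i. f ` H i" "\<lambda>i. f (x i)"] HJ by (simp add: carB)
    also have "\<dots> \<longleftrightarrow> (\<forall>a\<in>carrier A. \<exists>i\<in>J. a \<otimes>\<^bsub>A\<^esub> inv\<^bsub>A\<^esub> x i \<in> H i)"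
    proof (intro ball_cong bex_cong refl)
      fix a i assume a: "a \<in> carrier A" and i: "i \<in> J"
      have "f a \<otimes>\<^bsub>B\<^esub> inv\<^bsub>B\<^esub> f (x i) = f (a \<otimes>\<^bsub>A\<^esub> inv\<^bsub>A\<^esub> x i)" using a HJ(2)[OF i] by simp
      then show "f a \<otimes>\<^bsub>B\<^esub> inv\<^bsub>B\<^esub> f (x i) \<in> f ` H i \<longleftrightarrow> a \<otimes>\<^bsub>A\<^esub> inv\<^bsub>A\<^esub> x i \<in> H i"
        using mem[of "a \<otimes>\<^bsub>A\<^esub> inv\<^bsub>A\<^esub> x i" i] a HJ(2)[OF i] i J by auto
    qed
    also have "\<dots> \<longleftrightarrow> (\<Union>i\<in>J. H i #>\<^bsub>A\<^esub> x i) = carrier A"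
      using A.Union_cosets_eq_carrier_iff[of J H x] HJ by simp
    finally show ?thesis .
  qed
  have "irredundant_coset_cover B k (\<lambda>i. f ` H i) (\<lambda>i. f (x i))"
    unfolding irredundant_coset_cover_def using cov_iff un irr sB x by (auto simp: psubset_imp_subset)
  moreover have "card (rcosets\<^bsub>B\<^esub> (Inter_in (carrier B) (\<lambda>i. f ` H i) {1..k})) = card (rcosets\<^bsub>A\<^esub> N)"
  proof -
    have "Inter_in (carrier B) (\<lambda>i. f ` H i) {1..k} = {\<one>\<^bsub>B\<^esub>}"
    proof
      show "Inter_in (carrier B) (\<lambda>i. f ` H i) {1..k} \<subseteq> {\<one>\<^bsub>B\<^esub>}"
      proof
        fix b assume b: "b \<in> Inter_in (carrier B) (\<lambda>i. f ` H i) {1..k}"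
        then obtain a where a: "a \<in> carrier A" "b = f a" by (auto simp: Inter_in_def carB)
        then have "a \<in> N" using b mem by (auto simp: Inter_in_def N_def)
        then have "f a = f \<one>\<^bsub>A\<^esub>" using f_eq[of a "\<one>\<^bsub>A\<^esub>"] a by simp
        then show "b \<in> {\<one>\<^bsub>B\<^esub>}" using a by simp
      qed
      show "{\<one>\<^bsub>B\<^esub>} \<subseteq> Inter_in (carrier B) (\<lambda>i. f ` H i) {1..k}"
        using sB by (auto simp: Inter_in_def subgroup.one_closed)
    qed
    then have "card (rcosets\<^bsub>B\<^esub> (Inter_in (carrier B) (\<lambda>i. f ` H i) {1..k})) = card (carrier B)"
      using f.H.card_rcosets_triv \<open>finite (carrier B)\<close> by (simp add: order_def)
    then show ?thesis using fB g by (simp add: card_image)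
  qed
  ultimately show ?thesis unfolding N_def by blast
qed

section \<open>The index of the intersection\<close>

lemma (in finite_comm_group) index_bound:
  assumes cov: "irredundant_coset_cover G k H x" and k: "0 < k" and h: "0 < h" "k * k < 2 ^ h"
  shows "card (rcosets (Inter_in (carrier G) H {1..k})) \<le> (h + 1) ^ k"
proof -
  have H: "\<And>i. i \<in> {1..k} \<Longrightarrow> subgroup (H i) G" and x: "\<And>i. i \<in> {1..k} \<Longrightarrow> x i \<in> carrier G"
    and irr: "\<And>J. J \<subset> {1..k} \<Longrightarrow> (\<Union>i\<in>J. H i #> x i) \<noteq> carrier G"
    and un: "(\<Union>i\<in>{1..k}. H i #> x i) = carrier G"
    using cov by (auto simp: irredundant_coset_cover_def)
  let ?c = "\<lambda>I. Inter_in (carrier G) H I" and ?w = "\<lambda>Y. weight (h + 1) (card Y)"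
  have sg: "subgroup (?c I) G" if "I \<subseteq> {1..k}" for I
    using that H by (intro Inter_in_subgroup subgroup_self) auto
  have wle: "?w (carrier G) \<le> ?w (?c {1..k}) + k"
  proof (rule ccontr)
    assume big: "\<not> ?thesis"
    \<comment> \<open>Weights of orders are additive, so up to the constant weight of the whole
      group this is \<open>card I\<close> minus the weight of the index; stated with orders it needs
      no subtraction.\<close>
    define f where "f I = card I + ?w (?c I)" for I
    have "\<exists>I. I \<subseteq> {1..k} \<and> (\<forall>J. J \<subseteq> {1..k} \<longrightarrow> f J \<le> f I)"
    proof (rule ex_has_greatest_nat[of "\<lambda>I. I \<subseteq> {1..k}" "{}" f "Suc (Max (f ` Pow {1..k}))"])
      show "\<forall>J. J \<subseteq> {1..k} \<longrightarrow> f J < Suc (Max (f ` Pow {1..k}))"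
        by (auto simp: less_Suc_eq_le intro!: Max_ge)
    qed simp
    then obtain I where I: "I \<subseteq> {1..k}" and I_max: "\<And>J. J \<subseteq> {1..k} \<Longrightarrow> f J \<le> f I" by blast
    have finI: "finite I" using I finite_subset by blast
    have "f {} \<le> f I" by (rule I_max) simp
    \<comment> \<open>By assumption the full index set has \<open>f {1..k} < f {}\<close>.\<close>
    then have "I \<noteq> {1..k}" using big by (auto simp: f_def)
    then have Ik: "I \<subset> {1..k}" using I by blast
    then have "(\<Union>i\<in>I. H i #> x i) \<noteq> carrier G" by (rule irr)
    moreover have "(\<Union>i\<in>I. H i #> x i) = carrier G \<longleftrightarrow> (\<forall>a\<in>carrier G. \<exists>i\<in>I. a \<otimes> inv (x i) \<in> H i)"
      using I H x by (intro Union_cosets_eq_carrier_iff) auto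
    ultimately obtain z where z: "z \<in> carrier G" "\<And>i. i \<in> I \<Longrightarrow> z \<otimes> inv (x i) \<notin> H i" by blast
    define D where "D = ?c I"
    define E where "E = {1..k} - I"
    have D: "subgroup D G" unfolding D_def by (rule sg[OF I])
    have DG: "D \<subseteq> carrier G" using D by (rule subgroup.subset)
    \<comment> \<open>The coset \<open>j\<close> meets \<open>D #> z\<close> in nothing or in a
      translate of \<open>H j \<inter> D\<close>; after translation by \<open>inv z\<close>,
      \<open>b j\<close> represents it. The default \<open>\<one>\<close> covers the empty
      case.\<close>
    define b where "b j = (if \<exists>e\<in>D. e \<otimes> z \<otimes> inv (x j) \<in> H j
      then SOME e. e \<in> D \<and> e \<otimes> z \<otimes> inv (x j) \<in> H j else \<one>)" for j
    have b: "b j \<in> D \<and> (b j \<otimes> z \<otimes> inv (x j) \<in> H j \<or> (\<forall>e\<in>D. e \<otimes> z \<otimes> inv (x j) \<notin> H j))" for j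
    proof (cases "\<exists>e\<in>D. e \<otimes> z \<otimes> inv (x j) \<in> H j")
      case True
      then have "\<exists>e. e \<in> D \<and> e \<otimes> z \<otimes> inv (x j) \<in> H j" by blast
      from someI_ex[OF this] True show ?thesis by (simp add: b_def)
    qed (use D subgroup.one_closed in \<open>auto simp: b_def\<close>)
    have "\<exists>d\<in>D. \<forall>j\<in>E. d \<otimes> inv (b j) \<notin> H j \<inter> D"
    proof (rule avoid_cosets[OF h _ _ D])
      show "finite E" by (simp add: E_def)
      show "card E \<le> k" using card_mono[of "{1..k}" E] by (simp add: E_def)
      show "subgroup (H j \<inter> D) G" if "j \<in> E" for j
        using that H D by (intro subgroups_Inter_pair) (auto simp: E_def)
      show "b j \<in> D" for j using b by blast
      fix S assume S: "S \<subseteq> E"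
      have "Inter_in D (\<lambda>j. H j \<inter> D) S = ?c (I \<union> S)" by (auto simp: Inter_in_def D_def)
      moreover have "card (I \<union> S) = card I + card S"
        using S finI finite_subset[of S "{1..k}"] by (intro card_Un_disjoint) (auto simp: E_def)
      \<comment> \<open>Maximality of \<open>I\<close> is precisely the weight hypothesis of
        \<open>avoid_cosets\<close> in \<open>D\<close>.\<close>
      moreover have "f (I \<union> S) \<le> f I" using I S by (intro I_max) (auto simp: E_def)
      ultimately show "?w (Inter_in D (\<lambda>j. H j \<inter> D) S) + card S \<le> ?w D" by (simp add: f_def D_def)
    qed auto
    then obtain d where d: "d \<in> D" "\<And>j. j \<in> E \<Longrightarrow> d \<otimes> inv (b j) \<notin> H j \<inter> D" by blast
    have dG: "d \<in> carrier G" using d DG by blast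
    have "\<forall>a\<in>carrier G. \<exists>i\<in>{1..k}. a \<otimes> inv (x i) \<in> H i"
      using un Union_cosets_eq_carrier_iff[of "{1..k}" H x] H x by blast
    then obtain i where i: "i \<in> {1..k}" "d \<otimes> z \<otimes> inv (x i) \<in> H i" using dG z by blast
    have y: "z \<otimes> inv (x i) \<in> carrier G" using z x i by simp
    show False
    proof (cases "i \<in> I")
      case True
      then have "d \<in> H i" using d(1) by (simp add: D_def Inter_in_def)
      then have "inv d \<otimes> (d \<otimes> z \<otimes> inv (x i)) \<in> H i"
        using i H by (simp add: subgroup.m_closed subgroup.m_inv_closed)
      moreover have "inv d \<otimes> (d \<otimes> z \<otimes> inv (x i)) = z \<otimes> inv (x i)"
        using dG z x[OF i(1)] by (simp add: m_assoc[symmetric])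
      ultimately show False using z(2)[OF True] by simp
    next
      case False
      then have iE: "i \<in> E" using i by (simp add: E_def)
      have bD: "b i \<in> D" and bH: "b i \<otimes> z \<otimes> inv (x i) \<in> H i" using b[of i] d(1) i(2) by auto
      have bG: "b i \<in> carrier G" using bD DG by blast
      have "(d \<otimes> z \<otimes> inv (x i)) \<otimes> inv (b i \<otimes> z \<otimes> inv (x i)) \<in> H i"
        using i bH H by (simp add: subgroup.m_closed subgroup.m_inv_closed)
      also have "(d \<otimes> z \<otimes> inv (x i)) \<otimes> inv (b i \<otimes> z \<otimes> inv (x i))
          = (d \<otimes> (z \<otimes> inv (x i))) \<otimes> inv (b i \<otimes> (z \<otimes> inv (x i)))"
        using dG bG z x[OF i(1)] by (simp add: m_assoc)
      also have "\<dots> = d \<otimes> inv (b i)"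
        using dG bG y by (simp only: inv_mult m_ac m_closed inv_closed)
          (simp add: m_assoc[symmetric])
      finally have "d \<otimes> inv (b i) \<in> H i \<inter> D"
        using d(1) bD D by (simp add: subgroup.m_closed subgroup.m_inv_closed)
      with d(2)[OF iE] show False by contradiction
    qed
  qed
  have lagr: "card (rcosets (?c {1..k})) * card (?c {1..k}) = card (carrier G)"
    using lagrange[OF sg[OF subset_refl]] by (simp add: order_def)
  have cpos: "0 < card (?c {1..k})" using card_subgroup_pos[OF sg[OF subset_refl]] .
  have "0 < card (carrier G)" using card_subgroup_pos[OF subgroup_self] .
  then have pos: "card (rcosets (?c {1..k})) \<noteq> 0" using lagr by (metis mult_0 less_irrefl)
  have "?w (carrier G) = weight (h + 1) (card (rcosets (?c {1..k}))) + ?w (?c {1..k})"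
    unfolding lagr[symmetric] using pos cpos by (intro weight_mult) auto
  then have "weight (h + 1) (card (rcosets (?c {1..k}))) \<le> k" using wle by simp
  moreover have "card (rcosets (?c {1..k})) \<le> (h + 1) ^ weight (h + 1) (card (rcosets (?c {1..k})))"
    using h pos by (intro le_power_weight) auto
  ultimately show ?thesis
    using power_increasing[of _ k "h + 1"] by (meson le_add2 le_trans)
qed

section \<open>The exponential form of the bound\<close>

lemma Inter_in_cover_eq_Inter:
  assumes "irredundant_coset_cover A k H x" "0 < k"
  shows "Inter_in (carrier A) H {1..k} = (\<Inter>i\<in>{1..k}. H i)"
proof -
  have "H 1 \<subseteq> carrier A" using assms by (auto simp: irredundant_coset_cover_def subgroup.subset)
  then show ?thesis using assms(2) by (auto simp: Inter_in_def)
qed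

lemma irredundant_cover_index_bound:
  assumes A: "comm_group A" and cov: "irredundant_coset_cover A k H x" and k: "0 < k"
    and h: "0 < h" "k * k < 2 ^ h"
  shows "card (rcosets\<^bsub>A\<^esub> (Inter_in (carrier A) H {1..k})) \<le> (h + 1) ^ k"
proof -
  obtain B :: "nat monoid" and H' x' where B: "comm_group B" "finite (carrier B)"
    "irredundant_coset_cover B k H' x'"
    "card (rcosets\<^bsub>B\<^esub> (Inter_in (carrier B) H' {1..k})) = card (rcosets\<^bsub>A\<^esub> (Inter_in (carrier A) H {1..k}))"
    using cover_on_nat[OF A cov] by blast
  interpret finite_comm_group B by (intro finite_comm_group.intro finite_comm_group_axioms.intro B)
  show ?thesis using index_bound[OF B(3) k h] B(4) by simp
qed

text \<open>Makes \<open>ln (ln k)\<close> positive from \<open>k = 3\<close> on. The estimate is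
  \<open>e \<le> (21/16) ^ 4 < 3\<close>.\<close>

lemma ln_3_gt_1: "1 < ln (3::real)"
proof -
  have "exp (1/4 :: real) \<le> 1 + 1/4 + (1/4)^2" by (rule exp_bound) auto
  then have "exp (1/4 :: real) ^ 4 \<le> (21/16) ^ 4" by (intro power_mono) (auto simp: power2_eq_square)
  also have "\<dots> < (3::real)" by (simp add: power4_eq_xxxx)
  also have "exp (1/4 :: real) ^ 4 = exp 1" by (simp flip: exp_of_nat_mult)
  finally show ?thesis using ln_less_cancel_iff[of "exp 1" "3::real"] by simp
qed

lemma index_le_exp:
  obtains C :: real where "0 < C" "\<And>(A :: ('a, 'b) monoid_scheme) k H x. 3 \<le> k \<Longrightarrow> comm_group A \<Longrightarrow>
    irredundant_coset_cover A k H x \<Longrightarrow> index_le A (\<Inter>i\<in>{1..k}. H i) (exp (C * real k * ln (ln (real k))))"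
proof
  \<comment> \<open>\<open>K\<close> is chosen with \<open>h + 1 \<le> K * ln k\<close>;
    \<open>C\<close> then absorbs \<open>ln K\<close> into a multiple of \<open>ln (ln k)\<close>,
    using \<open>ln (ln k) \<ge> ln (ln 3) > 0\<close>.\<close>
  define K :: real where "K = 2 / ln 2 + 3"
  define C where "C = ln K / ln (ln 3) + 1"
  have K: "3 < K" by (simp add: K_def)
  have ll3: "0 < ln (ln (3::real))" using ln_3_gt_1 by simp
  show "0 < C" unfolding C_def using K ll3 by (intro add_nonneg_pos divide_nonneg_pos) auto
  fix A :: "('a, 'b) monoid_scheme" and k H x
  assume k: "3 \<le> (k::nat)" and A: "comm_group A" and cov: "irredundant_coset_cover A k H x"
  interpret comm_group A by fact
  have Inter_in: "Inter_in (carrier A) H {1..k} = (\<Inter>i\<in>{1..k}. H i)"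
    using Inter_in_cover_eq_Inter[OF cov] k by simp
  obtain m where m: "2 ^ m \<le> k" "k < 2 ^ (m + 1)" using ex_power_ivl1[of 2 k] k by auto
  \<comment> \<open>With \<open>m\<close> the rounded-down binary logarithm of \<open>k\<close>,
    this \<open>h\<close> satisfies \<open>k * k < 2 ^ h\<close> and is still of order
    \<open>ln k\<close>.\<close>
  define h where "h = 2 * (m + 1)"
  have "k * k < 2 ^ (m + 1) * 2 ^ (m + 1)" using m(2) by (intro mult_strict_mono) auto
  then have "k * k < 2 ^ h" by (simp only: h_def mult_2 power_add)
  then have "card (rcosets\<^bsub>A\<^esub> (\<Inter>i\<in>{1..k}. H i)) \<le> (h + 1) ^ k"
    unfolding Inter_in[symmetric] using k by (intro irredundant_cover_index_bound[OF A cov]) (simp_all add: h_def)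
  then have "real (card (rcosets\<^bsub>A\<^esub> (\<Inter>i\<in>{1..k}. H i))) \<le> (real h + 1) ^ k"
    by (metis of_nat_1 of_nat_add of_nat_le_iff of_nat_power)
  also have "(real h + 1) ^ k \<le> exp (C * real k * ln (ln (real k)))"
  proof -
    have lnk: "ln 3 \<le> ln (real k)" using k by simp
    then have lnk1: "1 < ln (real k)" using ln_3_gt_1 by linarith
    have llk: "ln (ln 3) \<le> ln (ln (real k))" using lnk ln_3_gt_1 by simp
    have "real m * ln 2 = ln (2 ^ m)" by (simp add: ln_realpow)
    also have "\<dots> \<le> ln (real k)" using m(1) k by (subst ln_le_cancel_iff) (auto simp flip: of_nat_le_iff)
    finally have "real m \<le> ln (real k) / ln 2" by (simp add: field_simps)
    then have "real h + 1 \<le> 2 * (ln (real k) / ln 2) + 3 * ln (real k)"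
      using lnk1 by (simp add: h_def)
    also have "\<dots> = K * ln (real k)" by (simp add: K_def algebra_simps)
    finally have "ln (real h + 1) \<le> ln (K * ln (real k))" using K lnk1 by (subst ln_le_cancel_iff) auto
    also have "\<dots> = ln K + ln (ln (real k))" using K lnk1 by (simp add: ln_mult)
    also have "ln K \<le> ln K / ln (ln 3) * ln (ln (real k))"
    proof -
      have "ln K * ln (ln 3) \<le> ln K * ln (ln (real k))" using llk K by (intro mult_left_mono) auto
      then show ?thesis using ll3 by (simp add: field_simps)
    qed
    finally have "ln (real h + 1) \<le> C * ln (ln (real k))" by (simp add: C_def algebra_simps)
    then have "real k * ln (real h + 1) \<le> real k * (C * ln (ln (real k)))" by (rule mult_left_mono) simp
    moreover have "(real h + 1) ^ k = exp (real k * ln (real h + 1))" by (simp add: exp_of_nat_mult)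
    ultimately show ?thesis by (simp add: mult_ac)
  qed
  finally show "index_le A (\<Inter>i\<in>{1..k}. H i) (exp (C * real k * ln (ln (real k))))"
    using irredundant_cover_finite_index[OF cov] unfolding index_le_def Inter_in by simp
qed

theorem theorem1p2:
  shows "0 < coset_cover_const \<and>
    (\<forall>(k::nat) (A :: ('a, 'b) monoid_scheme) H x.
       3 \<le> k \<longrightarrow> comm_group A \<longrightarrow> irredundant_coset_cover A k H x \<longrightarrow>
       index_le A (\<Inter>i\<in>{1..k}. H i) (exp (coset_cover_const * real k * ln (ln (real k)))))"
proof -
  let ?P = "\<lambda>C. 0 < C \<and> (\<forall>(k::nat) (A :: nat monoid) H x.
        3 \<le> k \<longrightarrow> comm_group A \<longrightarrow> irredundant_coset_cover A k H x \<longrightarrow>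
        index_le A (\<Inter>i\<in>{1..k}. H i) (exp (C * real k * ln (ln (real k)))))"
  \<comment> \<open>Existence at the element type \<open>nat\<close> makes the choice in
    \<open>coset_cover_const\<close> meaningful.\<close>
  have "\<exists>C. ?P C" by (rule index_le_exp[where ?'a = nat and ?'b = unit]) blast
  then have P: "?P coset_cover_const" unfolding coset_cover_const_def by (rule someI_ex)
  have "index_le A (\<Inter>i\<in>{1..k}. H i) (exp (coset_cover_const * real k * ln (ln (real k))))"
    if k: "3 \<le> k" and A: "comm_group A" and cov: "irredundant_coset_cover A k H x"
    for k and A :: "('a, 'b) monoid_scheme" and H x
  proof -
    \<comment> \<open>The chosen constant is known to work only for groups of natural numbers; a
      group over another type is replaced by one of these with the same index.\<close>
    obtain B :: "nat monoid" and H' x' where B: "comm_group B" "irredundant_coset_cover B k H' x'"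
      "card (rcosets\<^bsub>B\<^esub> (Inter_in (carrier B) H' {1..k})) = card (rcosets\<^bsub>A\<^esub> (Inter_in (carrier A) H {1..k}))"
      using cover_on_nat[OF A cov] by blast
    have Inter_in: "Inter_in (carrier A) H {1..k} = (\<Inter>i\<in>{1..k}. H i)" "Inter_in (carrier B) H' {1..k} = (\<Inter>i\<in>{1..k}. H' i)"
      using Inter_in_cover_eq_Inter[OF cov] Inter_in_cover_eq_Inter[OF B(2)] k by simp_all
    interpret comm_group A by fact
    have "index_le B (\<Inter>i\<in>{1..k}. H' i) (exp (coset_cover_const * real k * ln (ln (real k))))"
      using P k B by blast
    then show ?thesis
      using B(3) irredundant_cover_finite_index[OF cov] unfolding index_le_def Inter_in by simp
  qed
  with P show ?thesis by blast
qed

end
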